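(* Let $(Q,\triangleleft_\lambda,\triangleright_\lambda)$ be a finite Leibniz-dendriform conformal algebra which is free as a $\mathbf{k}[\partial]$-module. Let $\{a^i\}_{i=1}^n$ be a $\mathbf{k}[\partial]$-basis of $Q$ and $\{a_i\}_{i=1}^n$ the dual $\mathbf{k}[\partial]$-basis of $Q^{*c}$. Then $$r=\sum_{i=1}^n(a_i\otimes a^i+a^i\otimes a_i)$$ is a solution of the classical Leibniz conformal Yang-Baxter equation (CLCYBE) in the Leibniz conformal algebra $Q\ltimes_{L_\triangleleft^*,-L_\triangleleft^*-R_\triangleright^*}Q^{*c}$, where $Q$ carries the $\lambda$-bracket $[a_\lambda b]=a\triangleright_\lambda b+a\triangleleft_\lambda b$.
   Context: $\mathbf{k}$ is a field of characteristic zero; tensors are over $\mathbf{k}$. A Leibniz conformal algebra is a $\mathbf{k}[\partial]$-module $Q$ with a $\mathbf{k}$-bilinear map $[\cdot_\lambda\cdot]:Q\times Q\to Q[\lambda]$ with $[\partial a_\lambda b]=-\lambda[a_\lambda b]$, $[a_\lambda\partial b]=(\lambda+\partial)[a_\lambda b]$, $[a_\lambda[b_\mu c]]=[[a_\lambda b]_{\lambda+\mu}c]+[b_\mu[a_\lambda c]]$. A Leibniz-dendriform conformal algebra is a $\mathbf{k}[\partial]$-module $Q$ with two $\mathbf{k}$-bilinear $\lambda$-products $\triangleleft_\lambda,\triangleright_\lambda:Q\times Q\to Q[\lambda]$ such that for all $a,b,c\in Q$: $(\partial a)\triangleleft_\lambda b=-\lambda\,a\triangleleft_\lambda b$, $a\triangleleft_\lambda(\partial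 b)=(\lambda+\partial)(a\triangleleft_\lambda b)$, $(\partial a)\triangleright_\lambda b=-\lambda\,a\triangleright_\lambda b$, $a\triangleright_\lambda(\partial b)=(\lambda+\partial)(a\triangleright_\lambda b)$, and $a\triangleright_\lambda(b\triangleright_\mu c+b\triangleleft_\mu c)=(a\triangleright_\lambda b)\triangleright_{\lambda+\mu}c+b\triangleleft_\mu(a\triangleright_\lambda c)$; $a\triangleleft_\lambda(b\triangleright_\mu c)=(a\triangleleft_\lambda b)\triangleright_{\lambda+\mu}c+b\triangleright_\mu(a\triangleright_\lambda c+a\triangleleft_\lambda c)$; $a\triangleleft_\lambda(b\triangleleft_\mu c)=(a\triangleright_\lambda b+a\triangleleft_\lambda b)\triangleleft_{\lambda+\mu}c+b\triangleleft_\mu(a\triangleleft_\lambda c)$. It is finite if finitely generated over $\mathbf{k}[\partial]$. Then $[a_\lambda b]=a\triangleright_\lambda b+a\triangleleft_\lambda b$ makes $Q$ a Leibniz conformal algebra. Substitution convention: when a formal variable in a polynomial with module coefficients is replaced by an expression containing $\partial$ or $\partial_i$, one first computes the polynomial and then lets the expression act on its coefficients. For $\mathbf{k}[\partial]$-modules $U,V$, a conformal linear map is a $\mathbf{k}$-linear $a_\lambda:U\to V[\lambda]$ with $a_\lambda(\partial u)=(\lambda+\partial)a_\lambda u$; they form the $\mathbf{k}[\partial]$-module $\mathrm{Chom}(U,V)$ with $(\partial a)_\lambda u=-\lambda a_\lambda u$; $\mathrm{Cend}(V)=\mathrm{Chom}(V,V)$; $U^{*c}=\mathrm{Chom}(U,\mathbf{k})$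 with $\mathbf{k}$ the trivial module; $\langle f,u\rangle_\lambda=f_\lambda u$. The dual basis satisfies $(a_i)_\lambda a^j=\delta_{ij}$. $L_\triangleleft,R_\triangleright:Q\to\mathrm{Cend}(Q)$ are given by $L_\triangleleft(a)_\lambda b=a\triangleleft_\lambda b$ and $R_\triangleright(a)_{-\lambda-\partial}b=b\triangleright_\lambda a$; their duals $Q\to\mathrm{Cend}(Q^{*c})$ are $\langle L_\triangleleft^*(a)_\lambda f,b\rangle_\mu=-\langle f,L_\triangleleft(a)_\lambda b\rangle_{\mu-\lambda}$, $\langle R_\triangleright^*(a)_\lambda f,b\rangle_\mu=-\langle f,R_\triangleright(a)_\lambda b\rangle_{\mu-\lambda}$. $Q\ltimes_{l,r}N$ denotes $Q\oplus N$ with $[(a+x)_\lambda(b+y)]=[a_\lambda b]+l(a)_\lambda y+r(b)_{-\lambda-\partial}x$. CLCYBE in a Leibniz conformal algebra $P$: let $\partial_1,\partial_2,\partial_3$ be $\partial$ acting on the factors of $P^{\otimes3}$ and $\partial^{\otimes^3}=\partial_1+\partial_2+\partial_3$. For $r=\sum_ic_i\otimes d_i\in P\otimes P$ put $$[[r,r]]=\sum_{i,j}[{c_i}_\mu c_j]\otimes d_i\otimes d_j|_{\mu=\partial_2}+\sum_{i,j}c_i\otimes c_j\otimes[{d_j}_\mu d_i]|_{\mu=\partial_2}-\sum_{i,j}c_i\otimes[{d_i}_\mu c_j]\otimes d_j|_{\mu=\partial_1}-\sum_{i,j}c_i\otimes[{c_j}_\mu d_i]\otimes d_j|_{\mu=-\partial_1-\partial_2}.$$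 $r$ is a solution of the CLCYBE in $P$ if $[[r,r]]\in\partial^{\otimes^3}(P\otimes P\otimes P)$. *)

theory Defs
  imports "HOL-Computational_Algebra.Polynomial" "HOL-Library.Poly_Mapping"
    "HOL-Library.Function_Algebras" "HOL-Library.Product_Plus"
begin

text \<open>
  A \<open>k[\<partial>]\<close>-module is a module (in the sense of the locale \<^locale>\<open>module\<close>) over \<^typ>\<open>'k poly\<close>,
  where \<open>\<partial>\<close> is the indeterminate and \<open>k\<close> acts through the constant polynomials.
  For a module \<open>M\<close>, the space \<open>M[\<lambda>]\<close> is \<^typ>\<open>'m poly\<close>; multiplication by \<open>\<lambda>\<close> is \<open>pCons 0\<close>,
  and an endomorphism of \<open>M\<close> acts on coefficients by \<^const>\<open>map_poly\<close>.
\<close>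

abbreviation kscale :: "('k::field poly \<Rightarrow> 'm \<Rightarrow> 'm) \<Rightarrow> 'k \<Rightarrow> 'm \<Rightarrow> 'm"
  where "kscale s c \<equiv> s [:c:]"

abbreviation del :: "('k::field poly \<Rightarrow> 'm \<Rightarrow> 'm) \<Rightarrow> 'm \<Rightarrow> 'm"
  where "del s \<equiv> s [:0, 1:]"

text \<open>
  Substitution of an operator for the formal variable: if \<open>p = \<Sum>n. \<mu>^n v\<^sub>n\<close>, then
  \<open>psubst E F p\<close> is \<open>\<Sum>n. E^n (F v\<^sub>n)\<close>, i.e. the coefficients are first mapped to the target
  space by \<open>F\<close>, and the expression \<open>E\<close> replacing \<open>\<mu>\<close> then acts on them.
\<close>

definition psubst :: "('b \<Rightarrow> 'b) \<Rightarrow> ('m::zero \<Rightarrow> 'b::comm_monoid_add) \<Rightarrow> 'm poly \<Rightarrow> 'b"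
  where "psubst E F p = (\<Sum>n\<le>degree p. (E ^^ n) (F (coeff p n)))"

text \<open>\<open>p(\<lambda>) \<mapsto> p(-\<lambda>-\<partial>)\<close> on \<open>M[\<lambda>]\<close>; this is an involution.\<close>

definition flip :: "('k::field poly \<Rightarrow> 'm \<Rightarrow> 'm) \<Rightarrow> 'm::ab_group_add poly \<Rightarrow> 'm poly"
  where "flip s = psubst (\<lambda>q. - pCons 0 q - map_poly (del s) q) (\<lambda>v. [:v:])"

definition lambda_product ::
    "('k::field poly \<Rightarrow> 'm \<Rightarrow> 'm) \<Rightarrow> 'm set \<Rightarrow> ('m::ab_group_add \<Rightarrow> 'm \<Rightarrow> 'm poly) \<Rightarrow> bool"
  where "lambda_product s P m \<longleftrightarrow>
    (\<forall>a\<in>P. \<forall>b\<in>P. \<forall>n. coeff (m a b) n \<in> P) \<and>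
    (\<forall>a\<in>P. \<forall>a'\<in>P. \<forall>b\<in>P. m (a + a') b = m a b + m a' b) \<and>
    (\<forall>a\<in>P. \<forall>b\<in>P. \<forall>b'\<in>P. m a (b + b') = m a b + m a b') \<and>
    (\<forall>c. \<forall>a\<in>P. \<forall>b\<in>P. m (kscale s c a) b = map_poly (kscale s c) (m a b)) \<and>
    (\<forall>c. \<forall>a\<in>P. \<forall>b\<in>P. m a (kscale s c b) = map_poly (kscale s c) (m a b)) \<and>
    (\<forall>a\<in>P. \<forall>b\<in>P. m (del s a) b = - pCons 0 (m a b)) \<and>
    (\<forall>a\<in>P. \<forall>b\<in>P. m a (del s b) = pCons 0 (m a b) + map_poly (del s) (m a b))"

text \<open>
  \<open>P[\<lambda>,\<mu>]\<close> is \<^typ>\<open>'m poly poly\<close> with \<open>\<mu>\<close> the outer and \<open>\<lambda>\<close> the inner variable.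
  The following three operators are multiplication by \<open>\<lambda>\<close>, \<open>\<mu>\<close> and \<open>\<lambda>+\<mu>\<close>.
\<close>

definition Lam :: "'m::ab_group_add poly poly \<Rightarrow> 'm poly poly"
  where "Lam = map_poly (pCons 0)"

definition Mu :: "'m::ab_group_add poly poly \<Rightarrow> 'm poly poly"
  where "Mu = pCons 0"

definition LamMu :: "'m::ab_group_add poly poly \<Rightarrow> 'm poly poly"
  where "LamMu q = Lam q + Mu q"

text \<open>
  \<open>prod_at m E a b\<close> is \<open>m a b\<close> with variable \<open>E\<close>; \<open>nest_right m E m' E' a b c\<close> is
  \<open>m\<^sub>E a (m'\<^sub>E\<^sub>' b c)\<close>, and \<open>nest_left m' E' m E a b c\<close> is \<open>m\<^sub>E (m'\<^sub>E\<^sub>' a b) c\<close>.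
\<close>

definition prod_at :: "('m::ab_group_add \<Rightarrow> 'm \<Rightarrow> 'm poly) \<Rightarrow> ('m poly poly \<Rightarrow> 'm poly poly)
    \<Rightarrow> 'm \<Rightarrow> 'm \<Rightarrow> 'm poly poly"
  where "prod_at m E a b = psubst E (\<lambda>v. [:[:v:]:]) (m a b)"

definition nest_right :: "('m::ab_group_add \<Rightarrow> 'm \<Rightarrow> 'm poly) \<Rightarrow> ('m poly poly \<Rightarrow> 'm poly poly)
    \<Rightarrow> ('m \<Rightarrow> 'm \<Rightarrow> 'm poly) \<Rightarrow> ('m poly poly \<Rightarrow> 'm poly poly) \<Rightarrow> 'm \<Rightarrow> 'm \<Rightarrow> 'm \<Rightarrow> 'm poly poly"
  where "nest_right m E m' E' a b c = psubst E' (\<lambda>v. prod_at m E a v) (m' b c)"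

definition nest_left :: "('m::ab_group_add \<Rightarrow> 'm \<Rightarrow> 'm poly) \<Rightarrow> ('m poly poly \<Rightarrow> 'm poly poly)
    \<Rightarrow> ('m \<Rightarrow> 'm \<Rightarrow> 'm poly) \<Rightarrow> ('m poly poly \<Rightarrow> 'm poly poly) \<Rightarrow> 'm \<Rightarrow> 'm \<Rightarrow> 'm \<Rightarrow> 'm poly poly"
  where "nest_left m' E' m E a b c = psubst E' (\<lambda>v. prod_at m E v c) (m' a b)"

text \<open>
  The underlying module is a submodule \<open>P\<close> of a type carrying a \<open>k[\<partial>]\<close>-module structure
  (needed since the conformal dual is a proper submodule of a function type).
\<close>

definition leibniz_conformal_algebra ::
    "('k::field_char_0 poly \<Rightarrow> 'm \<Rightarrow> 'm) \<Rightarrow> 'm set \<Rightarrow> ('m::ab_group_add \<Rightarrow> 'm \<Rightarrow> 'm poly) \<Rightarrow> bool"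
  where "leibniz_conformal_algebra s P br \<longleftrightarrow>
    module s \<and> module.subspace s P \<and> lambda_product s P br \<and>
    (\<forall>a\<in>P. \<forall>b\<in>P. \<forall>c\<in>P.
      nest_right br Lam br Mu a b c = nest_left br Lam br LamMu a b c + nest_right br Mu br Lam b a c)"

definition sum_product :: "('m::ab_group_add \<Rightarrow> 'm \<Rightarrow> 'm poly) \<Rightarrow> ('m \<Rightarrow> 'm \<Rightarrow> 'm poly)
    \<Rightarrow> 'm \<Rightarrow> 'm \<Rightarrow> 'm poly"
  where "sum_product rt lt a b = rt a b + lt a b"

locale leibniz_dendriform_conformal_algebra =
  module scale for scale :: "'k::field_char_0 poly \<Rightarrow> 'q::ab_group_add \<Rightarrow> 'q" +
  fixes lt rt :: "'q \<Rightarrow> 'q \<Rightarrow> 'q poly"  \<comment> \<open>\<open>a \<triangleleft>\<^sub>\<lambda> b\<close> and \<open>a \<triangleright>\<^sub>\<lambda> b\<close>\<close>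
  assumes lt_product: "lambda_product scale UNIV lt"
    and rt_product: "lambda_product scale UNIV rt"
    and dendriform1: "nest_right rt Lam (sum_product rt lt) Mu a b c =
      nest_left rt Lam rt LamMu a b c + nest_right lt Mu rt Lam b a c"
    and dendriform2: "nest_right lt Lam rt Mu a b c =
      nest_left lt Lam rt LamMu a b c + nest_right rt Mu (sum_product rt lt) Lam b a c"
    and dendriform3: "nest_right lt Lam lt Mu a b c =
      nest_left (sum_product rt lt) Lam lt LamMu a b c + nest_right lt Mu lt Lam b a c"

definition Chom :: "('k::field poly \<Rightarrow> 'u \<Rightarrow> 'u) \<Rightarrow> ('k poly \<Rightarrow> 'v \<Rightarrow> 'v)
    \<Rightarrow> ('u::ab_group_add \<Rightarrow> 'v::ab_group_add poly) set"
  where "Chom s t = {f.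
    (\<forall>u v. f (u + v) = f u + f v) \<and>
    (\<forall>c u. f (kscale s c u) = map_poly (kscale t c) (f u)) \<and>
    (\<forall>u. f (del s u) = pCons 0 (f u) + map_poly (del t) (f u))}"

definition triv_scale :: "'k::field poly \<Rightarrow> 'k \<Rightarrow> 'k"
  where "triv_scale p c = coeff p 0 * c"

definition conf_dual :: "('k::field poly \<Rightarrow> 'q \<Rightarrow> 'q) \<Rightarrow> ('q::ab_group_add \<Rightarrow> 'k poly) set"
  where "conf_dual s = Chom s triv_scale"

text \<open>Since \<open>(\<partial>f)\<^sub>\<lambda> u = -\<lambda> f\<^sub>\<lambda> u\<close>, the polynomial \<open>p(\<partial>)\<close> acts on the dual by multiplication with \<open>p(-\<lambda>)\<close>.\<close>

definition dual_scale :: "'k::field poly \<Rightarrow> ('q \<Rightarrow> 'k poly) \<Rightarrow> 'q \<Rightarrow> 'k poly"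
  where "dual_scale p f = (\<lambda>u. pcompose p [:0, -1:] * f u)"

text \<open>\<open>p(\<lambda>) \<mapsto> p(\<mu>-\<lambda>)\<close>, as a polynomial with outer variable \<open>\<lambda>\<close> and inner variable \<open>\<mu>\<close>.\<close>

definition mu_minus_lam :: "'k::field poly \<Rightarrow> 'k poly poly"
  where "mu_minus_lam p = pcompose (map_poly (\<lambda>c. [:c:]) p) [:[:0, 1:], -1:]"

text \<open>
  The dual \<open>T\<^sup>*\<close> of \<open>T : Q \<rightarrow> Cend(Q)\<close>, determined by
  \<open>\<langle>T\<^sup>*(a)\<^sub>\<lambda> f, b\<rangle>\<^sub>\<mu> = -\<langle>f, T(a)\<^sub>\<lambda> b\<rangle>\<^sub>\<mu>\<^sub>-\<^sub>\<lambda>\<close>. The coefficient of \<open>\<lambda>^m\<close> in \<open>T\<^sup>*(a)\<^sub>\<lambda> f\<close> is the map sending \<open>b\<close>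
  to the coefficient of \<open>\<lambda>^m\<close> in the right-hand side (a polynomial in \<open>\<mu>\<close>). If \<open>Q\<close> is finitely
  generated over \<open>k[\<partial>]\<close>, only finitely many of these maps are nonzero, so that
  \<^const>\<open>Abs_poly\<close> is meaningful.
\<close>

definition dual_action :: "('q \<Rightarrow> 'q \<Rightarrow> 'q::ab_group_add poly)
    \<Rightarrow> 'q \<Rightarrow> ('q \<Rightarrow> 'k::field poly) \<Rightarrow> ('q \<Rightarrow> 'k poly) poly"
  where "dual_action T a f =
    Abs_poly (\<lambda>m b. coeff (- psubst (pCons 0) (\<lambda>v. mu_minus_lam (f v)) (T a b)) m)"

definition left_mult :: "('q \<Rightarrow> 'q \<Rightarrow> 'q::ab_group_add poly) \<Rightarrow> 'q \<Rightarrow> 'q \<Rightarrow> 'q poly"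
  where "left_mult m a b = m a b"

text \<open>\<open>R(a)\<^sub>-\<^sub>\<lambda>\<^sub>-\<^sub>\<partial> b = m\<^sub>\<lambda> b a\<close> is solved for \<open>R(a)\<^sub>\<lambda> b\<close> because \<^const>\<open>flip\<close> is an involution.\<close>

definition right_mult :: "('k::field poly \<Rightarrow> 'q \<Rightarrow> 'q) \<Rightarrow> ('q \<Rightarrow> 'q \<Rightarrow> 'q::ab_group_add poly)
    \<Rightarrow> 'q \<Rightarrow> 'q \<Rightarrow> 'q poly"
  where "right_mult s m a b = flip s (m b a)"

definition sum_scale :: "('k::field poly \<Rightarrow> 'q \<Rightarrow> 'q) \<Rightarrow> ('k poly \<Rightarrow> 'n \<Rightarrow> 'n)
    \<Rightarrow> 'k poly \<Rightarrow> 'q \<times> 'n \<Rightarrow> 'q \<times> 'n"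
  where "sum_scale s t p x = (s p (fst x), t p (snd x))"

text \<open>The bracket \<open>[(a+x)\<^sub>\<lambda> (b+y)] = [a\<^sub>\<lambda> b] + l(a)\<^sub>\<lambda> y + r(b)\<^sub>-\<^sub>\<lambda>\<^sub>-\<^sub>\<partial> x\<close>; \<open>t\<close> is the scalar action on \<open>N\<close>.\<close>

definition semidirect_bracket :: "('k::field poly \<Rightarrow> 'n \<Rightarrow> 'n) \<Rightarrow> ('q \<Rightarrow> 'q \<Rightarrow> 'q::ab_group_add poly)
    \<Rightarrow> ('q \<Rightarrow> 'n \<Rightarrow> 'n poly) \<Rightarrow> ('q \<Rightarrow> 'n \<Rightarrow> 'n poly)
    \<Rightarrow> 'q \<times> 'n \<Rightarrow> 'q \<times> 'n \<Rightarrow> ('q \<times> 'n::ab_group_add) poly"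
  where "semidirect_bracket t br l r = (\<lambda>(a, x) (b, y).
    map_poly (\<lambda>q. (q, 0)) (br a b) + map_poly (\<lambda>z. (0, z)) (l a y + flip t (r b x)))"

text \<open>
  \<open>P\<^bsup>\<otimes>n\<^esup>\<close> is the quotient of the \<open>k\<close>-vector space freely generated by the lists of length \<open>n\<close> over
  \<open>P\<close> by the multilinearity relations; its elements are the cosets.
\<close>

definition formal_tensors :: "'p set \<Rightarrow> nat \<Rightarrow> ('p list \<Rightarrow>\<^sub>0 'k::field) set"
  where "formal_tensors P n = {x. Poly_Mapping.keys x \<subseteq> {xs. length xs = n \<and> set xs \<subseteq> P}}"

definition pure :: "'p list \<Rightarrow> ('p list \<Rightarrow>\<^sub>0 'k::field)"
  where "pure xs = Poly_Mapping.single xs 1"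

definition fscale :: "'k::field \<Rightarrow> ('p list \<Rightarrow>\<^sub>0 'k) \<Rightarrow> ('p list \<Rightarrow>\<^sub>0 'k)"
  where "fscale c = Poly_Mapping.map ((*) c)"

definition tensor_relations ::
    "('k::field poly \<Rightarrow> 'p \<Rightarrow> 'p) \<Rightarrow> 'p::ab_group_add set \<Rightarrow> nat \<Rightarrow> ('p list \<Rightarrow>\<^sub>0 'k) set"
  where "tensor_relations s P n =
    {pure (us @ (x + y) # vs) - pure (us @ x # vs) - pure (us @ y # vs) | us vs x y.
       x \<in> P \<and> y \<in> P \<and> set us \<subseteq> P \<and> set vs \<subseteq> P \<and> length us + 1 + length vs = n} \<union>
    {pure (us @ kscale s c x # vs) - fscale c (pure (us @ x # vs)) | us vs c x.
       x \<in> P \<and> set us \<subseteq> P \<and> set vs \<subseteq> P \<and> length us + 1 + length vs = n}"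

definition tensor_class ::
    "('k::field poly \<Rightarrow> 'p \<Rightarrow> 'p) \<Rightarrow> 'p::ab_group_add set \<Rightarrow> nat \<Rightarrow> ('p list \<Rightarrow>\<^sub>0 'k) \<Rightarrow> ('p list \<Rightarrow>\<^sub>0 'k) set"
  where "tensor_class s P n x = {y. y - x \<in> module.span fscale (tensor_relations s P n)}"

definition tensor_power ::
    "('k::field poly \<Rightarrow> 'p \<Rightarrow> 'p) \<Rightarrow> 'p::ab_group_add set \<Rightarrow> nat \<Rightarrow> ('p list \<Rightarrow>\<^sub>0 'k) set set"
  where "tensor_power s P n = tensor_class s P n ` formal_tensors P n"

text \<open>\<open>\<partial>\<close> acting on the factor with (0-based) index \<open>i\<close>, on representatives.\<close>

definition tensor_del ::
    "('k::field poly \<Rightarrow> 'p \<Rightarrow> 'p) \<Rightarrow> nat \<Rightarrow> ('p list \<Rightarrow>\<^sub>0 'k) \<Rightarrow> ('p list \<Rightarrow>\<^sub>0 'k)"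
  where "tensor_del s i t =
    (\<Sum>xs\<in>Poly_Mapping.keys t. Poly_Mapping.single (xs[i := del s (xs ! i)]) (Poly_Mapping.lookup t xs))"

text \<open>The subspace \<open>(\<partial>\<^sub>1 + \<dots> + \<partial>\<^sub>n) P\<^bsup>\<otimes>n\<^esup>\<close> of \<open>P\<^bsup>\<otimes>n\<^esup>\<close>.\<close>

definition total_del_image ::
    "('k::field poly \<Rightarrow> 'p \<Rightarrow> 'p) \<Rightarrow> 'p::ab_group_add set \<Rightarrow> nat \<Rightarrow> ('p list \<Rightarrow>\<^sub>0 'k) set set"
  where "total_del_image s P n =
    (\<lambda>t. tensor_class s P n (\<Sum>i<n. tensor_del s i t)) ` formal_tensors P n"

text \<open>\<open>[[r,r]]\<close> for \<open>r = \<Sum>i<m. c\<^sub>i \<otimes> d\<^sub>i\<close>, as a representative in the free vector space.\<close>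

definition yb_bracket :: "('k::field poly \<Rightarrow> 'p \<Rightarrow> 'p) \<Rightarrow> ('p \<Rightarrow> 'p \<Rightarrow> 'p::ab_group_add poly)
    \<Rightarrow> nat \<Rightarrow> (nat \<Rightarrow> 'p) \<Rightarrow> (nat \<Rightarrow> 'p) \<Rightarrow> ('p list \<Rightarrow>\<^sub>0 'k)"
  where "yb_bracket s br m c d =
    (let d1 = tensor_del s 0; d2 = tensor_del s 1 in
      (\<Sum>i<m. \<Sum>j<m. psubst d2 (\<lambda>v. pure [v, d i, d j]) (br (c i) (c j))) +
      (\<Sum>i<m. \<Sum>j<m. psubst d2 (\<lambda>v. pure [c i, c j, v]) (br (d j) (d i))) -
      (\<Sum>i<m. \<Sum>j<m. psubst d1 (\<lambda>v. pure [c i, v, d j]) (br (d i) (c j))) -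
      (\<Sum>i<m. \<Sum>j<m. psubst (\<lambda>t. - d1 t - d2 t) (\<lambda>v. pure [c i, v, d j]) (br (c j) (d i))))"

text \<open>
  The class of \<open>[[r,r]]\<close> does not depend on how \<open>r\<close> is written as \<open>\<Sum>i<m. c\<^sub>i \<otimes> d\<^sub>i\<close>;
  the condition is imposed for all such presentations (there is always at least one).
\<close>

definition CLCYBE_solution :: "('k::field_char_0 poly \<Rightarrow> 'p \<Rightarrow> 'p) \<Rightarrow> 'p set
    \<Rightarrow> ('p \<Rightarrow> 'p \<Rightarrow> 'p::ab_group_add poly) \<Rightarrow> ('p list \<Rightarrow>\<^sub>0 'k) set \<Rightarrow> bool"
  where "CLCYBE_solution s P br r \<longleftrightarrow>
    leibniz_conformal_algebra s P br \<and> r \<in> tensor_power s P 2 \<and>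
    (\<forall>m c d. (\<forall>i<m. c i \<in> P \<and> d i \<in> P) \<longrightarrow> r = tensor_class s P 2 (\<Sum>i<m. pure [c i, d i]) \<longrightarrow>
      tensor_class s P 3 (yb_bracket s br m c d) \<in> total_del_image s P 3)"

end

theory Submission imports Defs begin

text \<open>
The proof replaces every formal variable, and every \<open>\<partial>\<close>, by a scalar. This loses nothing because the
field is infinite and the modules are free: an identity in \<open>Q[\<lambda>,\<mu>]\<close> holds if it holds for all scalar
values of \<open>\<lambda>\<close> and \<open>\<mu>\<close> (\<open>ev2_eq_iff\<close>), and an element \<open>f\<close> of \<open>Q\<^sup>*\<^sup>c\<close> is a family of functionals
\<open>f\<^sub>t\<close> on \<open>Q\<close>, \<open>t \<in> k\<close>, with \<open>f\<^sub>t(\<partial>u) = t f\<^sub>t(u)\<close>. In scalar form the bracket of the semidirect product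
is
\<open>([a\<^sub>\<lambda> g])\<^sub>t(c) = -g\<^sub>t\<^sub>-\<^sub>\<lambda>(a \<triangleleft>\<^sub>\<lambda> c)\<close> and
\<open>([f\<^sub>\<lambda> b])\<^sub>t(c) = f\<^sub>\<lambda>(b \<triangleleft>\<^sub>t\<^sub>-\<^sub>\<lambda> c + c \<triangleright>\<^sub>-\<^sub>t b)\<close>,
and the Leibniz identity follows from the dendriform identities (\<open>leibniz_DB\<close>).

For the Yang-Baxter equation, \<open>P = Q \<oplus> Q\<^sup>*\<^sup>c\<close> carries the symmetric conformal pairing
\<open>\<langle>b+f, c+g\<rangle>\<^sub>x = f\<^sub>x(c) + g\<^sub>-\<^sub>x(b)\<close>, and \<open>r\<close> is its canonical tensor \<open>\<Sum>e\<^sub>i \<otimes> e\<^sub>i'\<close>. Since \<open>P\<close> is free, the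
quotient of \<open>P \<otimes> P \<otimes> P\<close> by the image of \<open>\<partial>\<^sub>1+\<partial>\<^sub>2+\<partial>\<^sub>3\<close> is a free module over polynomials in two
variables, so that its elements are detected by the functionals
\<open>\<langle>w\<^sub>1,-\<rangle>\<^sub>x \<otimes> \<langle>w\<^sub>2,-\<rangle>\<^sub>y \<otimes> \<langle>w\<^sub>3,-\<rangle>\<^sub>z\<close> with \<open>x+y+z = 0\<close> (\<open>evaluations_separate\<close>). Contracting with the
canonical tensor turns the equation \<open>[[r,r]] = 0\<close> into the invariance of the pairing
\<open>\<langle>w\<^sub>1,[w\<^sub>2 \<^sub>y w\<^sub>3]\<rangle>\<^sub>x + \<langle>w\<^sub>3,[w\<^sub>2 \<^sub>y w\<^sub>1]\<rangle>\<^sub>z = \<langle>w\<^sub>2,[w\<^sub>1 \<^sub>x w\<^sub>3]\<rangle>\<^sub>y + \<langle>w\<^sub>2,[w\<^sub>3 \<^sub>z w\<^sub>1]\<rangle>\<^sub>y\<close>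
(\<open>casimir_solves_CLCYBE\<close>). This last identity is a direct consequence of the formula for the bracket
(\<open>pairing_invariant\<close>).
\<close>


section \<open>Substituting operators for a formal variable\<close>

lemma psubst_closed:
  assumes "\<And>n. F (coeff p n) \<in> V" "0 \<in> V" "\<And>u v. u \<in> V \<Longrightarrow> v \<in> V \<Longrightarrow> u + v \<in> V"
    and "\<And>v. v \<in> V \<Longrightarrow> E v \<in> V"
  shows "psubst E F p \<in> V"
proof -
  have iter: "(E ^^ n) v \<in> V" if "v \<in> V" for n v
    using that by (induction n) (auto simp: assms)
  have "(\<Sum>n\<le>N. (E ^^ n) (F (coeff p n))) \<in> V" for N
    by (induction N) (auto simp: assms iter)
  then show ?thesis unfolding psubst_def by auto
qed

text \<open>
An additive map that carries the operator \<open>E\<close> to \<open>E'\<close> commutes with substitution. All formal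
variables are eliminated through this principle. The set \<open>V\<close> is there because products are
controlled only on a submodule, so that \<open>h\<close> need not be additive on the whole type.
\<close>

lemma psubst_transfer:
  assumes "\<And>n. F (coeff p n) \<in> V" "0 \<in> V" "\<And>u v. u \<in> V \<Longrightarrow> v \<in> V \<Longrightarrow> u + v \<in> V"
    and "\<And>v. v \<in> V \<Longrightarrow> E v \<in> V"
    and h: "h 0 = 0" "\<And>u v. u \<in> V \<Longrightarrow> v \<in> V \<Longrightarrow> h (u + v) = h u + h v"
      "\<And>v. v \<in> V \<Longrightarrow> h (E v) = E' (h v)"
  shows "h (psubst E F p) = psubst E' (\<lambda>v. h (F v)) p"
proof -
  have iter: "(E ^^ n) v \<in> V \<and> h ((E ^^ n) v) = (E' ^^ n) (h v)" if "v \<in> V" for n v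
    using that by (induction n) (auto simp: assms)
  have "(\<Sum>n\<le>N. (E ^^ n) (F (coeff p n))) \<in> V \<and>
    h (\<Sum>n\<le>N. (E ^^ n) (F (coeff p n))) = (\<Sum>n\<le>N. (E' ^^ n) (h (F (coeff p n))))" for N
    by (induction N) (auto simp: assms iter)
  then show ?thesis
    unfolding psubst_def by auto
qed

lemma psubst_additive_image:
  assumes "additive h" "\<And>v. h (E v) = E' (h v)"
  shows "h (psubst E F p) = psubst E' (\<lambda>v. h (F v)) p"
  by (rule psubst_transfer[where V = UNIV])
    (use assms in \<open>auto simp: additive.zero additive.add\<close>)

lemma sum_coeff_extend:
  assumes "\<And>n. g n 0 = 0" "degree p \<le> N"
  shows "(\<Sum>n\<le>degree p. g n (coeff p n)) = (\<Sum>n\<le>N. g n (coeff p n))"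
  by (rule sum.mono_neutral_left) (use assms in \<open>auto simp: coeff_eq_0\<close>)

lemma sum_coeff_add:
  assumes "\<And>n u v. g n (u + v) = g n u + (g n v :: 'b::ab_group_add)"
  shows "(\<Sum>n\<le>degree (p + q). g n (coeff (p + q) n)) =
    (\<Sum>n\<le>degree p. g n (coeff p n)) + (\<Sum>n\<le>degree q. g n (coeff q n))"
proof -
  have 0: "g n 0 = 0" for n using assms[of n 0 0] by simp
  let ?N = "max (degree p) (degree q)"
  note ext = sum_coeff_extend[of g, OF 0, of _ ?N]
  show ?thesis
    by (subst (1 2 3) ext) (auto simp: degree_add_le_max assms sum.distrib)
qed

lemma additive_funpow: "additive E \<Longrightarrow> additive (E ^^ n)" for E :: "'b::ab_group_add \<Rightarrow> 'b"
  by (induction n) (simp_all add: additive_def)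

lemma additive_psubst:
  assumes "additive E" "additive F"
  shows "additive (psubst E F)"
  unfolding psubst_def
  by (rule additive.intro, rule sum_coeff_add)
    (simp add: additive.add[OF assms(2)] additive.add[OF additive_funpow[OF assms(1)]])

lemma psubst_eq_sum:
  assumes "additive E" "F 0 = 0" "degree p \<le> N"
  shows "psubst E F p = (\<Sum>n\<le>N. (E ^^ n) (F (coeff p n)))"
  unfolding psubst_def
  by (rule sum_coeff_extend)
    (use assms in \<open>auto simp: additive.zero[OF additive_funpow]\<close>)

lemma psubst_const: "psubst E F [:v:] = F v"
  by (simp add: psubst_def)

lemma psubst_pCons:
  assumes "additive E" "F 0 = 0"
  shows "psubst E F (pCons v p) = F v + E (psubst E F p)"
proof -
  have "psubst E F (pCons v p) = (\<Sum>n\<le>Suc (degree p). (E ^^ n) (F (coeff (pCons v p) n)))"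
    by (rule psubst_eq_sum) (use assms in \<open>auto simp: degree_pCons_le\<close>)
  also have "\<dots> = F v + E (psubst E F p)"
    by (subst sum.atMost_Suc_shift) (simp add: psubst_def additive.sum[OF assms(1)])
  finally show ?thesis .
qed

lemma psubst_map_poly:
  assumes "additive E" "F 0 = 0" "g 0 = 0"
  shows "psubst E F (map_poly g p) = psubst E (\<lambda>v. F (g v)) p"
proof -
  have "psubst E F (map_poly g p) = (\<Sum>n\<le>degree p. (E ^^ n) (F (coeff (map_poly g p) n)))"
    by (rule psubst_eq_sum) (use assms in \<open>auto simp: map_poly_degree_leq\<close>)
  then show ?thesis using assms by (simp add: psubst_def coeff_map_poly)
qed

section \<open>Evaluating formal variables at scalars\<close>

text \<open>
Used twice: with \<open>S = 0\<close> to reduce vector-valued polynomials to scalar ones, and with \<open>S\<close> the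
space of tensors that vanish modulo the total derivative.
\<close>

lemma separating_functional:
  fixes sc :: "'k::field \<Rightarrow> 'v::ab_group_add \<Rightarrow> 'v"
  assumes "vector_space sc" "module.subspace sc S" "v \<notin> S"
  obtains \<phi> :: "'v \<Rightarrow> 'k" where "additive \<phi>" "\<And>c u. \<phi> (sc c u) = c * \<phi> u"
    "\<And>u. u \<in> S \<Longrightarrow> \<phi> u = 0" "\<phi> v = 1"
proof -
  interpret vs: vector_space sc by fact
  interpret k: vector_space "(*) :: 'k \<Rightarrow> 'k \<Rightarrow> 'k" by unfold_locales (auto simp: algebra_simps)
  interpret vector_space_pair sc "(*) :: 'k \<Rightarrow> 'k \<Rightarrow> 'k" by unfold_locales
  obtain B where B: "B \<subseteq> S" "vs.independent B" "S \<subseteq> vs.span B"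
    using vs.maximal_independent_subset[of S] by blast
  have spB: "vs.span B = S" using B(1,3) vs.span_minimal[OF _ assms(2)] by (intro subset_antisym) auto
  then have "vs.independent (insert v B)"
    using B(2) assms(3) by (simp add: vs.independent_insertI)
  then obtain \<phi> where \<phi>: "Vector_Spaces.linear sc (*) \<phi>" "\<forall>x\<in>insert v B. \<phi> x = (if x = v then 1 else 0)"
    using linear_independent_extend[of "insert v B" "\<lambda>x. if x = v then 1 else 0"] by blast
  then interpret \<phi>: Vector_Spaces.linear sc "(*)" \<phi> by simp
  have "\<phi> u = 0" if "u \<in> S" for u
  proof (rule linear_eq_0_on_span[OF \<phi>(1)])
    show "\<phi> x = 0" if "x \<in> B" for x
      using \<phi>(2) that assms(3) B(1) by (metis insertCI subsetD)
    show "u \<in> vs.span B" using that spB by simp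
  qed
  then show thesis
    using that[of \<phi>] \<phi>(2) by (auto simp: additive_def \<phi>.add \<phi>.scale)
qed

definition ev :: "('k \<Rightarrow> 'm \<Rightarrow> 'm) \<Rightarrow> 'k \<Rightarrow> 'm::ab_group_add poly \<Rightarrow> 'm"
  where "ev sc l = psubst (sc l) (\<lambda>v. v)"

lemma additive_scale: "vector_space sc \<Longrightarrow> additive (sc c)"
  by (simp add: additive_def vector_space.vector_space_assms(1))

lemma additive_id: "additive (\<lambda>v. v)" by (simp add: additive_def)

context
  fixes sc :: "'k::field \<Rightarrow> 'm::ab_group_add \<Rightarrow> 'm"
  assumes vs: "vector_space sc"
begin

interpretation vector_space sc by (rule vs)

lemma additive_ev: "additive (ev sc l)"
  unfolding ev_def by (intro additive_psubst additive_scale vs additive_id)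

lemma ev_add: "ev sc l (p + q) = ev sc l p + ev sc l q"
  and ev_diff: "ev sc l (p - q) = ev sc l p - ev sc l q"
  and ev_minus: "ev sc l (- p) = - ev sc l p"
  and ev_0: "ev sc l 0 = 0"
  using additive_ev by (auto simp: additive.add additive.diff additive.minus additive.zero)

lemma ev_pCons: "ev sc l (pCons v p) = v + sc l (ev sc l p)"
  unfolding ev_def by (intro psubst_pCons additive_scale vs) simp

lemma ev_map_poly:
  assumes "additive h" "\<And>v. h (sc l v) = sc l (h v)"
  shows "ev sc l (map_poly h p) = h (ev sc l p)"
  unfolding ev_def
  by (simp add: psubst_map_poly additive_scale vs additive.zero[OF assms(1)]
      psubst_additive_image[where E = "sc l" and E' = "sc l", OF assms])

lemma additive_ev_image:
  assumes "additive h" "\<And>v. h (sc l v) = E (h v)"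
  shows "h (ev sc l p) = psubst E h p"
  unfolding ev_def by (rule psubst_additive_image[where E = "sc l" and E' = E and F = "\<lambda>v. v", OF assms])

end

lemma poly_eq_psubst: "poly p l = psubst ((*) l) (\<lambda>v. v) p" for p :: "'k::field poly"
proof -
  have "((*) l ^^ n) c = l ^ n * c" for n c by (induction n) auto
  then show ?thesis by (simp add: poly_altdef psubst_def mult.commute)
qed

lemma additive_mult: "additive ((*) (l::'k::field))"
  by (simp add: additive_def algebra_simps)

text \<open>
A nonzero coefficient is detected by a linear functional, and a scalar polynomial over an infinite
field is determined by its values. Hence identities with formal variables may be checked with
scalars in place of the variables.
\<close>

lemma ev_eq_iff:
  fixes sc :: "'k::field_char_0 \<Rightarrow> 'm::ab_group_add \<Rightarrow> 'm"
  assumes vs: "vector_space sc"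
  shows "p = q \<longleftrightarrow> (\<forall>l. ev sc l p = ev sc l q)"
proof
  assume eq: "\<forall>l. ev sc l p = ev sc l q"
  show "p = q"
  proof (rule ccontr)
    assume "p \<noteq> q"
    then have "lead_coeff (p - q) \<notin> {0}"
      by (simp del: coeff_diff)
    moreover have "module.subspace sc {0}"
      by (intro module.subspace_single_0) (use vs in \<open>simp add: module_iff_vector_space\<close>)
    ultimately obtain \<phi> :: "'m \<Rightarrow> 'k" where \<phi>: "additive \<phi>" "\<And>c u. \<phi> (sc c u) = c * \<phi> u"
      "\<phi> (lead_coeff (p - q)) = 1"
      using separating_functional[OF vs] by metis
    have "poly (map_poly \<phi> (p - q)) l = 0" for l
    proof -
      have "poly (map_poly \<phi> (p - q)) l = psubst ((*) l) \<phi> (p - q)"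
        by (simp add: poly_eq_psubst psubst_map_poly additive_mult additive.zero[OF \<phi>(1)])
      also have "\<dots> = \<phi> (ev sc l (p - q))"
        using additive_ev_image[OF vs \<phi>(1)] \<phi>(2) by metis
      finally show ?thesis using eq by (simp add: ev_diff[OF vs] additive.zero[OF \<phi>(1)])
    qed
    then have "map_poly \<phi> (p - q) = 0"
      by (intro iffD1[OF poly_eq_poly_eq_iff] ext) simp
    then have "\<phi> (lead_coeff (p - q)) = 0"
      by (metis coeff_0 coeff_map_poly additive.zero[OF \<phi>(1)])
    with \<phi>(3) show False by simp
  qed
qed simp

lemma vector_space_smult: "vector_space (smult :: 'k::field \<Rightarrow> 'k poly \<Rightarrow> 'k poly)"
  by unfold_locales (auto simp: smult_add_right smult_add_left)

lemma poly_poly_eqI: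
  fixes p q :: "'k::field_char_0 poly poly"
  assumes "\<And>l m. poly (poly p [:l:]) m = poly (poly q [:l:]) m"
  shows "p = q"
proof -
  have "ev smult l p = poly p [:l:]" for l and p :: "'k poly poly"
    by (induction p) (auto simp: ev_pCons[OF vector_space_smult] ev_0[OF vector_space_smult])
  moreover have "poly p [:l:] = poly q [:l:]" for l
    by (rule iffD1[OF poly_eq_poly_eq_iff]) (rule ext, rule assms)
  ultimately show ?thesis using ev_eq_iff[OF vector_space_smult, of p q] by simp
qed

text \<open>
The outer variable \<open>\<mu>\<close> takes the value \<open>m\<close>, the inner variable \<open>\<lambda>\<close> the value \<open>l\<close>.
\<close>

definition ev2 :: "('k \<Rightarrow> 'm \<Rightarrow> 'm) \<Rightarrow> 'k \<Rightarrow> 'k \<Rightarrow> 'm::ab_group_add poly poly \<Rightarrow> 'm"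
  where "ev2 sc l m = psubst (sc m) (ev sc l)"

context
  fixes sc :: "'k::field \<Rightarrow> 'm::ab_group_add \<Rightarrow> 'm"
  assumes vs: "vector_space sc"
begin

interpretation vector_space sc by (rule vs)

lemma additive_ev2: "additive (ev2 sc l m)"
  unfolding ev2_def by (intro additive_psubst additive_scale vs additive_ev)

lemma ev2_Mu: "ev2 sc l m (Mu q) = sc m (ev2 sc l m q)"
  unfolding Mu_def ev2_def
  by (subst psubst_pCons) (auto simp: additive_scale vs ev_0)

lemma ev2_Lam: "ev2 sc l m (Lam q) = sc l (ev2 sc l m q)"
proof -
  have "ev2 sc l m (Lam q) = psubst (sc m) (\<lambda>v. ev sc l (pCons 0 v)) q"
    unfolding Lam_def ev2_def by (rule psubst_map_poly) (auto simp: additive_scale vs ev_0)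
  also have "\<dots> = psubst (sc m) (\<lambda>v. sc l (ev sc l v)) q"
    by (simp add: ev_pCons[OF vs])
  also have "\<dots> = sc l (ev2 sc l m q)"
    unfolding ev2_def
    by (rule psubst_additive_image[symmetric]) (auto simp: additive_scale vs mult.commute)
  finally show ?thesis .
qed

lemma ev2_LamMu: "ev2 sc l m (LamMu q) = sc (l + m) (ev2 sc l m q)"
  by (simp add: LamMu_def additive.add[OF additive_ev2] ev2_Mu ev2_Lam scale_left_distrib)

lemma ev2_const: "ev2 sc l m [:[:v:]:] = v"
  by (simp add: ev2_def psubst_const ev_pCons[OF vs] ev_0[OF vs])

end

lemma ev2_eq_iff:
  fixes sc :: "'k::field_char_0 \<Rightarrow> 'm::ab_group_add \<Rightarrow> 'm"
  assumes vs: "vector_space sc"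
  shows "p = q \<longleftrightarrow> (\<forall>l m. ev2 sc l m p = ev2 sc l m q)"
proof
  assume eq: "\<forall>l m. ev2 sc l m p = ev2 sc l m q"
  have "ev2 sc l m r = ev sc m (map_poly (ev sc l) r)" for l m r
    unfolding ev2_def ev_def[of sc m]
    by (rule psubst_map_poly[symmetric]) (auto simp: additive_scale vs ev_0)
  then have "map_poly (ev sc l) p = map_poly (ev sc l) q" for l
    using eq ev_eq_iff[OF vs] by simp
  then have "ev sc l (coeff p n) = ev sc l (coeff q n)" for l n
    by (metis coeff_map_poly ev_0[OF vs])
  then show "p = q" by (simp add: poly_eq_iff[of p] ev_eq_iff[OF vs])
qed simp


section \<open>Modules over polynomials and their fibres\<close>

lemma vector_space_kscale:
  assumes "module s"
  shows "vector_space (kscale s)"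
proof -
  interpret module s by fact
  show ?thesis
    by unfold_locales
      (auto simp: scale_right_distrib scale_left_distrib[symmetric] mult.commute simp flip: one_pCons)
qed

lemma additive_module_scale: "module s \<Longrightarrow> additive (s p)"
  by (simp add: additive_def module_def)

lemma kscale_commute: "module s \<Longrightarrow> s p (kscale s c u) = kscale s c (s p u)"
  by (simp add: module.scale_scale)

lemma scale_pCons: "module s \<Longrightarrow> s (pCons c p) u = kscale s c u + del s (s p u)"
  using module.scale_left_distrib[of s "[:c:]" "pCons 0 p"] by (simp add: module.scale_scale)

lemma scale_eq_psubst:
  assumes "module s"
  shows "s p u = psubst (del s) (\<lambda>c. kscale s c u) p"
proof (induction p)
  case (pCons c p)
  then show ?case
    using assms
    by (subst psubst_pCons)
      (simp_all add: additive_module_scale scale_pCons[of s c p] module.scale_zero_left)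
qed (simp add: psubst_def assms module.scale_zero_left)

text \<open>
A functional on which \<open>\<partial>\<close> acts by a scalar \<open>t\<close> factors through the fibre of the module at
\<open>\<partial> = t\<close>. Such functionals turn conformal identities into identities between numbers.
\<close>

lemma fibre_scale:
  fixes H :: "'m::ab_group_add \<Rightarrow> 'k::field"
  assumes "module s" "module.subspace s P"
    and H: "\<And>u v. u \<in> P \<Longrightarrow> v \<in> P \<Longrightarrow> H (u + v) = H u + H v"
      "\<And>c u. u \<in> P \<Longrightarrow> H (kscale s c u) = c * H u"
      "\<And>u. u \<in> P \<Longrightarrow> H (del s u) = t * H u"
    and "u \<in> P"
  shows "H (s p u) = poly p t * H u"
proof (induction p)
  case 0
  then show ?case
    using H(2)[OF \<open>u \<in> P\<close>, of 0] assms(1) by (simp add: module.scale_zero_left)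
next
  case (pCons c p)
  have "s q v \<in> P" if "v \<in> P" for q v
    using module.subspace_scale[OF assms(1,2) that] .
  with pCons show ?case using \<open>u \<in> P\<close> by (simp add: scale_pCons[OF assms(1), of c p] H algebra_simps)
qed

text \<open>
Since \<open>\<partial>\<close> kills \<open>k\<close>, the condition \<open>f(\<partial>u) = (\<lambda>+\<partial>) f(u)\<close> becomes \<open>f(\<partial>u) = \<lambda> f(u)\<close>: the conformal
dual is the ordinary dual module with values in \<open>k[\<lambda>]\<close>.
\<close>

lemma conf_dual_iff:
  fixes s :: "'k::field poly \<Rightarrow> 'm::ab_group_add \<Rightarrow> 'm"
  assumes "module s"
  shows "f \<in> conf_dual s \<longleftrightarrow> (\<forall>u v. f (u + v) = f u + f v) \<and> (\<forall>p u. f (s p u) = p * f u)"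
proof -
  have triv: "map_poly (kscale triv_scale c) q = smult c q" "map_poly (del triv_scale) q = 0"
    for c :: 'k and q
    by (auto simp: triv_scale_def poly_eq_iff coeff_map_poly)
  show ?thesis
  proof
    assume f: "f \<in> conf_dual s"
    then have "additive f" by (simp add: additive_def conf_dual_def Chom_def)
    have "f (s p u) = p * f u" for p u
    proof (induction p)
      case 0
      then show ?case
        by (simp add: module.scale_zero_left[OF assms] additive.zero[OF \<open>additive f\<close>])
    next
      case (pCons c p)
      then show ?case
        using f by (simp add: scale_pCons[OF assms, of c p] conf_dual_def Chom_def triv)
    qed
    with f show "(\<forall>u v. f (u + v) = f u + f v) \<and> (\<forall>p u. f (s p u) = p * f u)"
      by (simp add: conf_dual_def Chom_def)
  qed (auto simp: conf_dual_def Chom_def triv)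
qed

lemma conf_dual_fibre:
  assumes "module s" "f \<in> conf_dual s"
  shows "poly (f (u + v)) t = poly (f u) t + poly (f v) t"
    and "poly (f (s p u)) t = poly p t * poly (f u) t"
    and "additive (\<lambda>u. poly (f u) t)"
  using assms by (auto simp: conf_dual_iff additive_def)

lemma fibre_ev:
  fixes H :: "'m::ab_group_add \<Rightarrow> 'k::field"
  assumes "module s" "additive H" "\<And>c u. H (kscale s c u) = c * H u"
  shows "H (ev (kscale s) l p) = psubst ((*) l) H p"
  by (rule additive_ev_image) (use assms vector_space_kscale in auto)

text \<open>
In the fibre at \<open>\<partial> = t\<close>, replacing \<open>\<lambda>\<close> by \<open>-\<lambda>-\<partial>\<close> is the change of value from \<open>l\<close> to \<open>-l-t\<close>.
\<close>

lemma fibre_flip: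
  fixes H :: "'m::ab_group_add \<Rightarrow> 'k::field"
  assumes s: "module s" and H: "additive H" "\<And>c u. H (kscale s c u) = c * H u"
    "\<And>u. H (del s u) = t * H u"
  shows "H (ev (kscale s) l (flip s p)) = H (ev (kscale s) (- l - t) p)"
proof -
  note vs = vector_space_kscale[OF s]
  have del: "additive (del s)" by (rule additive_module_scale[OF s])
  have "H (ev (kscale s) l (flip s p)) =
      psubst ((*) (- l - t)) (\<lambda>v. H (ev (kscale s) l [:v:])) p"
    unfolding flip_def
  proof (rule psubst_additive_image)
    show "additive (\<lambda>q. H (ev (kscale s) l q))"
      using H(1) by (simp add: additive_def ev_add[OF vs])
  next
    fix q
    have "ev (kscale s) l (map_poly (del s) q) = del s (ev (kscale s) l q)"
      by (rule ev_map_poly[OF vs del]) (rule kscale_commute[OF s])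
    then show "H (ev (kscale s) l (- pCons 0 q - map_poly (del s) q)) =
        (- l - t) * H (ev (kscale s) l q)"
      by (simp add: ev_diff[OF vs] ev_minus[OF vs] ev_pCons[OF vs] H additive.diff[OF H(1)]
          additive.minus[OF H(1)] algebra_simps)
  qed
  then show ?thesis
    by (simp add: fibre_ev[OF s H(1,2)] ev_pCons[OF vs] ev_0[OF vs] module.scale_zero_right[OF s])
qed

section \<open>Lambda products at scalars\<close>

abbreviation sprod ::
    "('k::field poly \<Rightarrow> 'm \<Rightarrow> 'm) \<Rightarrow> ('m \<Rightarrow> 'm \<Rightarrow> 'm::ab_group_add poly) \<Rightarrow> 'k \<Rightarrow> 'm \<Rightarrow> 'm \<Rightarrow> 'm"
  where "sprod s M l a b \<equiv> ev (kscale s) l (M a b)"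

text \<open>
What the axioms of a \<open>\<lambda>\<close>-product say about its values: a family of bilinear maps, one for each
scalar value of \<open>\<lambda>\<close>.
\<close>

definition sesquilinear ::
    "('k::field poly \<Rightarrow> 'm \<Rightarrow> 'm) \<Rightarrow> 'm set \<Rightarrow> ('k \<Rightarrow> 'm::ab_group_add \<Rightarrow> 'm \<Rightarrow> 'm) \<Rightarrow> bool"
  where "sesquilinear s P B \<longleftrightarrow>
    (\<forall>a\<in>P. \<forall>a'\<in>P. \<forall>b\<in>P. \<forall>l. B l (a + a') b = B l a b + B l a' b) \<and>
    (\<forall>a\<in>P. \<forall>b\<in>P. \<forall>b'\<in>P. \<forall>l. B l a (b + b') = B l a b + B l a b') \<and>
    (\<forall>c. \<forall>a\<in>P. \<forall>b\<in>P. \<forall>l. B l (kscale s c a) b = kscale s c (B l a b)) \<and>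
    (\<forall>c. \<forall>a\<in>P. \<forall>b\<in>P. \<forall>l. B l a (kscale s c b) = kscale s c (B l a b)) \<and>
    (\<forall>a\<in>P. \<forall>b\<in>P. \<forall>l. B l (del s a) b = - kscale s l (B l a b)) \<and>
    (\<forall>a\<in>P. \<forall>b\<in>P. \<forall>l. B l a (del s b) = kscale s l (B l a b) + del s (B l a b))"

lemma lambda_product_iff:
  fixes s :: "'k::field_char_0 poly \<Rightarrow> 'm::ab_group_add \<Rightarrow> 'm"
  assumes s: "module s"
  shows "lambda_product s P M \<longleftrightarrow>
    (\<forall>a\<in>P. \<forall>b\<in>P. \<forall>n. coeff (M a b) n \<in> P) \<and> sesquilinear s P (sprod s M)"
proof -
  note vs = vector_space_kscale[OF s]
  have map: "ev (kscale s) l (map_poly (s p) q) = s p (ev (kscale s) l q)" for l p q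
    by (intro ev_map_poly vs additive_module_scale s kscale_commute)
  have pC: "ev (kscale s) l (pCons 0 q) = kscale s l (ev (kscale s) l q)" for l q
    by (simp add: ev_pCons[OF vs])
  note eval = ev_add[OF vs] ev_minus[OF vs] pC map
  have "lambda_product s P M \<longleftrightarrow>
    (\<forall>a\<in>P. \<forall>b\<in>P. \<forall>n. coeff (M a b) n \<in> P) \<and>
    (\<forall>a\<in>P. \<forall>a'\<in>P. \<forall>b\<in>P. \<forall>l. sprod s M l (a + a') b = sprod s M l a b + sprod s M l a' b) \<and>
    (\<forall>a\<in>P. \<forall>b\<in>P. \<forall>b'\<in>P. \<forall>l. sprod s M l a (b + b') = sprod s M l a b + sprod s M l a b') \<and>
    (\<forall>c. \<forall>a\<in>P. \<forall>b\<in>P. \<forall>l. sprod s M l (kscale s c a) b = kscale s c (sprod s M l a b)) \<and>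
    (\<forall>c. \<forall>a\<in>P. \<forall>b\<in>P. \<forall>l. sprod s M l a (kscale s c b) = kscale s c (sprod s M l a b)) \<and>
    (\<forall>a\<in>P. \<forall>b\<in>P. \<forall>l. sprod s M l (del s a) b = - kscale s l (sprod s M l a b)) \<and>
    (\<forall>a\<in>P. \<forall>b\<in>P. \<forall>l. sprod s M l a (del s b) =
      kscale s l (sprod s M l a b) + del s (sprod s M l a b))"
    unfolding lambda_product_def by (simp only: ev_eq_iff[OF vs] eval)
  then show ?thesis by (simp only: sesquilinear_def)
qed

lemma sesquilinearD:
  assumes "sesquilinear s P B" "a \<in> P" "b \<in> P"
  shows "a' \<in> P \<Longrightarrow> B l (a + a') b = B l a b + B l a' b"
    "b' \<in> P \<Longrightarrow> B l a (b + b') = B l a b + B l a b'"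
    "B l (kscale s c a) b = kscale s c (B l a b)"
    "B l a (kscale s c b) = kscale s c (B l a b)"
    "B l (del s a) b = - kscale s l (B l a b)"
    "B l a (del s b) = kscale s l (B l a b) + del s (B l a b)"
  using assms unfolding sesquilinear_def by simp_all

lemma ev_in_subspace:
  assumes s: "module s" "module.subspace s P" and "\<And>n. coeff p n \<in> P"
  shows "ev (kscale s) l p \<in> P"
  unfolding ev_def
  by (rule psubst_closed)
    (use assms in \<open>auto simp: module.subspace_add module.subspace_0 module.subspace_scale\<close>)

lemma lambda_product_ev_left:
  fixes s :: "'k::field_char_0 poly \<Rightarrow> 'm::ab_group_add \<Rightarrow> 'm"
  assumes s: "module s" "module.subspace s P" and M: "lambda_product s P M"
    and "\<And>n. coeff p n \<in> P" "b \<in> P"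
  shows "psubst (kscale s l) (\<lambda>v. sprod s M l' v b) p = sprod s M l' (ev (kscale s) l p) b"
proof -
  note B = sesquilinearD[OF conjunct2[OF iffD1[OF lambda_product_iff[OF s(1)] M]]]
  have "sprod s M l' 0 b = 0"
    using B(1)[of 0 b 0] s assms(5) by (simp add: module.subspace_0)
  then show ?thesis
    unfolding ev_def[of _ l]
    by (intro psubst_transfer[where V = P, symmetric])
      (use assms B in \<open>auto simp: module.subspace_add module.subspace_0 module.subspace_scale\<close>)
qed

lemma lambda_product_ev_right:
  fixes s :: "'k::field_char_0 poly \<Rightarrow> 'm::ab_group_add \<Rightarrow> 'm"
  assumes s: "module s" "module.subspace s P" and M: "lambda_product s P M"
    and "\<And>n. coeff p n \<in> P" "a \<in> P"
  shows "psubst (kscale s l) (\<lambda>v. sprod s M l' a v) p = sprod s M l' a (ev (kscale s) l p)"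
proof -
  note B = sesquilinearD[OF conjunct2[OF iffD1[OF lambda_product_iff[OF s(1)] M]]]
  have "sprod s M l' a 0 = 0"
    using B(2)[of a 0 0] s assms(5) by (simp add: module.subspace_0)
  then show ?thesis
    unfolding ev_def[of _ l]
    by (intro psubst_transfer[where V = P, symmetric])
      (use assms B in \<open>auto simp: module.subspace_add module.subspace_0 module.subspace_scale\<close>)
qed

context
  fixes s :: "'k::field_char_0 poly \<Rightarrow> 'm::ab_group_add \<Rightarrow> 'm" and P M M' E E' e e' l m
  assumes s: "module s" "module.subspace s P"
    and M: "lambda_product s P M" and M': "lambda_product s P M'"
    and E: "\<And>q. ev2 (kscale s) l m (E q) = kscale s e (ev2 (kscale s) l m q)"
    and E': "\<And>q. ev2 (kscale s) l m (E' q) = kscale s e' (ev2 (kscale s) l m q)"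
begin

lemma ev2_prod_at: "ev2 (kscale s) l m (prod_at N E a b) = sprod s N e a b"
proof -
  note vs = vector_space_kscale[OF s(1)]
  show ?thesis
    unfolding prod_at_def ev_def[of _ e]
    by (subst psubst_additive_image[where h = "ev2 (kscale s) l m" and E = E
          and E' = "kscale s e", OF additive_ev2[OF vs] E])
      (simp add: ev2_const[OF vs])
qed

lemma ev2_nest_right:
  assumes "a \<in> P" "b \<in> P" "c \<in> P"
  shows "ev2 (kscale s) l m (nest_right M E M' E' a b c) = sprod s M e a (sprod s M' e' b c)"
proof -
  note vs = vector_space_kscale[OF s(1)]
  have "\<And>n. coeff (M' b c) n \<in> P" using M' assms by (simp add: lambda_product_def)
  then show ?thesis
    unfolding nest_right_def
    by (subst psubst_additive_image[where h = "ev2 (kscale s) l m" and E = "E'"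
          and E' = "kscale s e'", OF additive_ev2[OF vs] E'])
      (simp add: ev2_prod_at lambda_product_ev_right[OF s M] assms)
qed

lemma ev2_nest_left:
  assumes "a \<in> P" "b \<in> P" "c \<in> P"
  shows "ev2 (kscale s) l m (nest_left M' E' M E a b c) = sprod s M e (sprod s M' e' a b) c"
proof -
  note vs = vector_space_kscale[OF s(1)]
  have "\<And>n. coeff (M' a b) n \<in> P" using M' assms by (simp add: lambda_product_def)
  then show ?thesis
    unfolding nest_left_def
    by (subst psubst_additive_image[where h = "ev2 (kscale s) l m" and E = "E'"
          and E' = "kscale s e'", OF additive_ev2[OF vs] E'])
      (simp add: ev2_prod_at lambda_product_ev_left[OF s M] assms)
qed

end

text \<open>
The common shape of the Leibniz identity and of the three dendriform identities, for six possibly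
different products.
\<close>

lemma nested_identity_iff:
  fixes s :: "'k::field_char_0 poly \<Rightarrow> 'm::ab_group_add \<Rightarrow> 'm"
  assumes s: "module s" "module.subspace s P"
    and prods: "lambda_product s P M1" "lambda_product s P M2" "lambda_product s P M3"
      "lambda_product s P M4" "lambda_product s P M5" "lambda_product s P M6"
    and P: "a \<in> P" "b \<in> P" "c \<in> P"
  shows "nest_right M1 Lam M2 Mu a b c =
      nest_left M3 Lam M4 LamMu a b c + nest_right M5 Mu M6 Lam b a c \<longleftrightarrow>
    (\<forall>l m. sprod s M1 l a (sprod s M2 m b c) =
      sprod s M4 (l + m) (sprod s M3 l a b) c + sprod s M5 m b (sprod s M6 l a c))"
proof -
  note vs = vector_space_kscale[OF s(1)]
  note E = ev2_Lam[OF vs] ev2_Mu[OF vs] ev2_LamMu[OF vs]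
  have "ev2 (kscale s) l m (nest_right M1 Lam M2 Mu a b c) = sprod s M1 l a (sprod s M2 m b c)"
    "ev2 (kscale s) l m (nest_right M5 Mu M6 Lam b a c) = sprod s M5 m b (sprod s M6 l a c)"
    "ev2 (kscale s) l m (nest_left M3 Lam M4 LamMu a b c) =
      sprod s M4 (l + m) (sprod s M3 l a b) c" for l m
    by (rule ev2_nest_right ev2_nest_left; (rule s prods E P)?)+
  then show ?thesis
    by (simp add: ev2_eq_iff[OF vs] additive.add[OF additive_ev2[OF vs]])
qed


section \<open>The dual of a conformal action\<close>

lemma module_dual_scale: "module (dual_scale :: 'k::field poly \<Rightarrow> ('q \<Rightarrow> 'k poly) \<Rightarrow> 'q \<Rightarrow> 'k poly)"
  by unfold_locales
    (auto simp: dual_scale_def fun_eq_iff pcompose_add pcompose_mult pcompose_1 algebra_simps)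

lemma module_sum_scale: "module s \<Longrightarrow> module t \<Longrightarrow> module (sum_scale s t)"
  by (simp add: module_def sum_scale_def prod_eq_iff)

lemma subspace_conf_dual: "module s \<Longrightarrow> module.subspace dual_scale (conf_dual s)"
  unfolding module.subspace_def[OF module_dual_scale]
  by (auto simp: conf_dual_iff dual_scale_def algebra_simps)

lemma subspace_Times_conf_dual:
  "module s \<Longrightarrow> module.subspace (sum_scale s dual_scale) (UNIV \<times> conf_dual s)"
  using subspace_conf_dual[of s]
  by (auto simp: module.subspace_def module_dual_scale module_sum_scale sum_scale_def zero_prod_def)

lemma poly_poly_mu_minus_lam: "poly (poly (mu_minus_lam p) [:l:]) t = poly p (t - l)"
proof -
  have "poly (map_poly (\<lambda>c. [:c:]) p) q = pcompose p q" for q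
    by (induction p) (auto simp: map_poly_pCons pcompose_pCons)
  then show ?thesis by (simp add: mu_minus_lam_def poly_pcompose)
qed

text \<open>
The two hypotheses on \<open>T\<close> say that \<open>T(a)\<close> is a conformal linear map, tested against \<open>f\<close>. Then
\<open>b \<mapsto> \<langle>f, T(a)\<^sub>\<lambda> b\<rangle>\<^sub>\<mu>\<^sub>-\<^sub>\<lambda>\<close> is linear over \<open>k[\<mu>]\<close>, so its degree in \<open>\<lambda>\<close> is bounded by the degrees
on a finite set of generators. This bound is what makes the family of coefficients a polynomial.
\<close>

lemma dual_action:
  fixes s :: "'k::field_char_0 poly \<Rightarrow> 'q::ab_group_add \<Rightarrow> 'q"
  assumes s: "module s" and fg: "finite B" "module.span s B = UNIV"
    and f: "f \<in> conf_dual s"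
    and T: "\<And>l t b b'. poly (f (sprod s T l a (b + b'))) (t - l) =
        poly (f (sprod s T l a b)) (t - l) + poly (f (sprod s T l a b')) (t - l)"
      "\<And>l t p b. poly (f (sprod s T l a (s p b))) (t - l) =
        poly p t * poly (f (sprod s T l a b)) (t - l)"
  shows "coeff (dual_action T a f) n \<in> conf_dual s"
    and "poly (ev (kscale dual_scale) l (dual_action T a f) b) t =
      - poly (f (sprod s T l a b)) (t - l)"
proof -
  define W where "W b = - psubst (pCons 0) (\<lambda>v. mu_minus_lam (f v)) (T a b)" for b
  have W: "poly (poly (W b) [:l:]) t = - poly (f (sprod s T l a b)) (t - l)" for b l t
  proof -
    have "poly (poly (W b) [:l:]) t =
        - psubst ((*) l) (\<lambda>v. poly (poly (mu_minus_lam (f v)) [:l:]) t) (T a b)"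
      unfolding W_def
      by (subst psubst_additive_image[symmetric, where E = "pCons 0"])
        (auto simp: additive_def)
    also have "\<dots> = - poly (f (sprod s T l a b)) (t - l)"
      using conf_dual_fibre(2)[OF s f, of "[:_:]"]
      by (simp add: poly_poly_mu_minus_lam fibre_ev[OF s conf_dual_fibre(3)[OF s f]])
    finally show ?thesis .
  qed
  have W_add: "W (b + b') = W b + W b'" and W_scale: "W (s p b) = smult p (W b)" for b b' p
    by (rule poly_poly_eqI; simp add: W T)+
  \<comment> \<open>multiplying \<open>b\<close> by \<open>\<partial>\<close> multiplies \<open>W b\<close> by \<open>\<mu>\<close> and leaves the degree in \<open>\<lambda>\<close> unchanged\<close>
  obtain N where N: "\<And>b. b \<in> B \<Longrightarrow> degree (W b) \<le> N"
    using fg(1) by (metis Max_ge finite_imageI imageI)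
  have deg: "degree (W b) \<le> N" for b
  proof -
    have "module.subspace s {b. degree (W b) \<le> N}"
      unfolding module.subspace_def[OF s]
      using W_scale[of 0]
      by (auto simp: W_add W_scale module.scale_zero_left[OF s]
          intro: degree_add_le order_trans[OF degree_smult_le])
    with N have "module.span s B \<subseteq> {b. degree (W b) \<le> N}"
      by (intro module.span_minimal[OF s]) auto
    with fg(2) show ?thesis by auto
  qed
  have co: "coeff (dual_action T a f) = (\<lambda>m b. coeff (W b) m)"
    unfolding dual_action_def W_def[symmetric]
    by (rule coeff_Abs_poly[of N])
      (use deg in \<open>auto simp: fun_eq_iff intro!: coeff_eq_0 elim: le_less_trans[rotated]\<close>)
  show "coeff (dual_action T a f) n \<in> conf_dual s"
    by (simp add: co conf_dual_iff[OF s] W_add W_scale)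
  have "map_poly (\<lambda>g. g b) (dual_action T a f) = W b"
    by (simp add: poly_eq_iff coeff_map_poly co)
  then have "ev (kscale dual_scale) l (dual_action T a f) b = psubst (smult l) (\<lambda>v. v) (W b)"
    using additive_ev_image[OF vector_space_kscale[OF module_dual_scale],
        where h = "\<lambda>g. g b" and E = "smult l" and l = l and p = "dual_action T a f"]
      psubst_map_poly[OF additive_scale[OF vector_space_smult, of l],
        where F = "\<lambda>v. v" and g = "\<lambda>g. g b" and p = "dual_action T a f"]
    by (simp add: additive_def dual_scale_def)
  also have "poly \<dots> t = poly (poly (W b) [:l:]) t"
  proof -
    have "psubst (smult l) (\<lambda>v. v) p = poly p [:l:]" for p :: "'k poly poly"
      by (induction p)
        (auto simp: psubst_pCons additive_scale[OF vector_space_smult] psubst_def[of _ _ 0])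
    then show ?thesis by simp
  qed
  finally show "poly (ev (kscale dual_scale) l (dual_action T a f) b) t =
      - poly (f (sprod s T l a b)) (t - l)"
    by (simp add: W)
qed

section \<open>The semidirect product is a Leibniz conformal algebra\<close>

lemma ev_pair:
  assumes s: "module s" "module t"
  shows "ev (kscale (sum_scale s t)) l (map_poly (\<lambda>q. (q, 0)) p + map_poly (\<lambda>z. (0, z)) q) =
    (ev (kscale s) l p, ev (kscale t) l q)"
proof -
  note vs = vector_space_kscale[OF module_sum_scale[OF s]]
  have "ev (kscale (sum_scale s t)) l (map_poly (\<lambda>q. (q, 0)) p) = (ev (kscale s) l p, 0)"
    unfolding ev_def[of "kscale (sum_scale s t)"]
    by (subst psubst_map_poly[OF additive_scale[OF vs]])
      (auto simp: zero_prod_def additive_def sum_scale_def module.scale_zero_right[OF s(2)]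
        additive_ev_image[OF vector_space_kscale[OF s(1)], where h = "\<lambda>q. (q, 0)"
          and E = "kscale (sum_scale s t) l"])
  moreover have "ev (kscale (sum_scale s t)) l (map_poly (\<lambda>z. (0, z)) q) = (0, ev (kscale t) l q)"
    unfolding ev_def[of "kscale (sum_scale s t)"]
    by (subst psubst_map_poly[OF additive_scale[OF vs]])
      (auto simp: zero_prod_def additive_def sum_scale_def module.scale_zero_right[OF s(1)]
        additive_ev_image[OF vector_space_kscale[OF s(2)], where h = "\<lambda>z. (0, z)"
          and E = "kscale (sum_scale s t) l"])
  ultimately show ?thesis by (simp add: ev_add[OF vs])
qed

lemma coeff_flip_in_subspace:
  assumes s: "module s" "module.subspace s C" and p: "\<And>n. coeff p n \<in> C"
  shows "coeff (flip s p) n \<in> C"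
proof -
  have "flip s p \<in> {q. \<forall>n. coeff q n \<in> C}"
    unfolding flip_def
  proof (rule psubst_closed)
    show "[:coeff p n:] \<in> {q. \<forall>n. coeff q n \<in> C}" for n
      using p module.subspace_0[OF s] by (auto simp: coeff_pCons split: nat.split)
    show "- pCons 0 q - map_poly (del s) q \<in> {q. \<forall>n. coeff q n \<in> C}"
      if "q \<in> {q. \<forall>n. coeff q n \<in> C}" for q
      using that
      by (auto simp: coeff_pCons coeff_map_poly module.scale_zero_right[OF s(1)]
          intro!: module.subspace_diff[OF s] module.subspace_neg[OF s] module.subspace_scale[OF s]
          module.subspace_0[OF s] split: nat.split)
  qed (auto simp: module.subspace_add[OF s] module.subspace_0[OF s])
  then show ?thesis by simp
qed

context leibniz_dendriform_conformal_algebra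
begin

abbreviation L :: "'k \<Rightarrow> 'q \<Rightarrow> 'q \<Rightarrow> 'q" where "L \<equiv> sprod scale lt"
abbreviation R :: "'k \<Rightarrow> 'q \<Rightarrow> 'q \<Rightarrow> 'q" where "R \<equiv> sprod scale rt"

lemma module_scale: "module scale" by unfold_locales

lemmas lt_sesq = sesquilinearD[OF conjunct2[OF iffD1[OF lambda_product_iff[OF module_scale]
  lt_product]], OF UNIV_I UNIV_I, simplified]
lemmas rt_sesq = sesquilinearD[OF conjunct2[OF iffD1[OF lambda_product_iff[OF module_scale]
  rt_product]], OF UNIV_I UNIV_I, simplified]

lemma sprod_sum_product: "sprod scale (sum_product rt lt) l a b = R l a b + L l a b"
  by (simp add: sum_product_def ev_add[OF vector_space_kscale[OF module_scale]])

lemma sum_product_lambda: "lambda_product scale UNIV (sum_product rt lt)"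
  unfolding lambda_product_iff[OF module_scale] sesquilinear_def
  by (simp add: sprod_sum_product lt_sesq rt_sesq algebra_simps)

lemma
  shows dendriform_scalar1: "R l a (R m b c + L m b c) = R (l + m) (R l a b) c + L m b (R l a c)"
    and dendriform_scalar2: "L l a (R m b c) = R (l + m) (L l a b) c + R m b (R l a c + L l a c)"
    and dendriform_scalar3: "L l a (L m b c) = L (l + m) (R l a b + L l a b) c + L m b (L l a c)"
proof -
  note iff = nested_identity_iff[where P = UNIV, OF module_scale subspace_UNIV]
  note pr = lt_product rt_product sum_product_lambda
  show "R l a (R m b c + L m b c) = R (l + m) (R l a b) c + L m b (R l a c)"
    using dendriform1[of a b c] by (subst (asm) iff) (auto simp: pr sprod_sum_product)
  show "L l a (R m b c) = R (l + m) (L l a b) c + R m b (R l a c + L l a c)"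
    using dendriform2[of a b c] by (subst (asm) iff) (auto simp: pr sprod_sum_product)
  show "L l a (L m b c) = L (l + m) (R l a b + L l a b) c + L m b (L l a c)"
    using dendriform3[of a b c] by (subst (asm) iff) (auto simp: pr sprod_sum_product)
qed

text \<open>
The first dendriform identity for \<open>a, b\<close> and the second one for \<open>b, a\<close> contain the same two terms
\<open>a \<triangleright> (b \<triangleright> c + b \<triangleleft> c)\<close> and \<open>b \<triangleleft> (a \<triangleright> c)\<close> on opposite sides. What remains is
\<open>(a \<triangleright> b + b \<triangleleft> a) \<triangleright> c = 0\<close>.
\<close>

lemma R_left_cancel: "R (l + m) (R l a b) c + R (l + m) (L m b a) c = 0"
  using dendriform_scalar1[of l a m b c] dendriform_scalar2[of m b l a c]
  by (simp add: add.commute algebra_simps)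

end

locale finite_leibniz_dendriform = leibniz_dendriform_conformal_algebra scale lt rt
  for scale :: "'k::field_char_0 poly \<Rightarrow> 'q::ab_group_add \<Rightarrow> 'q" and lt rt +
  fixes B :: "'q set"
  assumes finite_B: "finite B" and span_B: "span B = UNIV"
begin

definition "Ls = dual_action (left_mult lt)"
definition "Rs = dual_action (right_mult scale rt)"
definition "double = UNIV \<times> conf_dual scale"
definition "double_scale = sum_scale scale dual_scale"
definition "double_bracket =
  semidirect_bracket dual_scale (sum_product rt lt) Ls (\<lambda>b f. - Ls b f - Rs b f)"

lemma module_double_scale: "module double_scale"
  unfolding double_scale_def by (rule module_sum_scale[OF module_scale module_dual_scale])

lemma subspace_double: "module.subspace double_scale double"
  unfolding double_scale_def double_def by (rule subspace_Times_conf_dual[OF module_scale])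

lemma sprod_left_mult: "sprod scale (left_mult lt) l a b = L l a b"
  by (simp add: left_mult_def)

text \<open>
By \<open>fibre_flip\<close>, the operator \<open>R(a)\<^sub>\<lambda>\<close> evaluated in the fibre at \<open>t\<close> is the product with \<open>\<lambda>\<close>
replaced by \<open>-\<lambda>-t\<close>. After the shift \<open>t \<mapsto> t-\<lambda>\<close> made by dualising only \<open>-t\<close> remains, which explains
the index that does not depend on \<open>l\<close> in the dual right action.
\<close>

lemma fibre_right_mult:
  assumes f: "f \<in> conf_dual scale"
  shows "poly (f (sprod scale (right_mult scale rt) l a b)) t = poly (f (R (- l - t) b a)) t"
  unfolding right_mult_def
  by (rule fibre_flip[OF module_scale])
    (use conf_dual_fibre[OF module_scale f] in auto)

lemma
  assumes f: "f \<in> conf_dual scale"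
  shows coeff_Ls: "coeff (Ls a f) n \<in> conf_dual scale"
    and poly_Ls: "poly (ev (kscale dual_scale) l (Ls a f) b) t = - poly (f (L l a b)) (t - l)"
proof -
  note act = dual_action[where T = "left_mult lt", OF module_scale finite_B span_B f]
  note fib = conf_dual_fibre(1,2)[OF module_scale f]
  have 1: "poly (f (L l a (b + b'))) (t - l) =
      poly (f (L l a b)) (t - l) + poly (f (L l a b')) (t - l)"
    for a l t b b' by (simp add: lt_sesq fib)
  have 2: "poly (f (L l a (scale p b))) (t - l) = poly p t * poly (f (L l a b)) (t - l)" for a l t p b
    by (rule fibre_scale[OF module_scale subspace_UNIV]) (auto simp: lt_sesq fib algebra_simps)
  show "coeff (Ls a f) n \<in> conf_dual scale"
    unfolding Ls_def by (rule act) (simp_all only: sprod_left_mult 1 2)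
  show "poly (ev (kscale dual_scale) l (Ls a f) b) t = - poly (f (L l a b)) (t - l)"
    unfolding Ls_def by (subst act) (simp_all only: sprod_left_mult 1 2)
qed

lemma
  assumes f: "f \<in> conf_dual scale"
  shows coeff_Rs: "coeff (Rs a f) n \<in> conf_dual scale"
    and poly_Rs: "poly (ev (kscale dual_scale) l (Rs a f) b) t = - poly (f (R (- t) b a)) (t - l)"
proof -
  note act = dual_action[where T = "right_mult scale rt", OF module_scale finite_B span_B f]
  note fib = conf_dual_fibre(1,2)[OF module_scale f]
  have 0: "poly (f (sprod scale (right_mult scale rt) l a b)) (t - l) = poly (f (R (- t) b a)) (t - l)"
    for a l t b by (simp add: fibre_right_mult[OF f])
  have 1: "poly (f (R (- t) (b + b') a)) (t - l) =
      poly (f (R (- t) b a)) (t - l) + poly (f (R (- t) b' a)) (t - l)"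
    for a l t b b' by (simp add: rt_sesq fib)
  have minus: "poly (f (- u)) t = - poly (f u) t" for u t
    using additive.minus[OF conf_dual_fibre(3)[OF module_scale f]] .
  have 2: "poly (f (R (- t) (scale p b) a)) (t - l) = poly p t * poly (f (R (- t) b a)) (t - l)" for a l t p b
    by (rule fibre_scale[OF module_scale subspace_UNIV]) (auto simp: rt_sesq fib minus)
  show "coeff (Rs a f) n \<in> conf_dual scale"
    unfolding Rs_def by (rule act) (simp_all only: 0 1 2)
  show "poly (ev (kscale dual_scale) l (Rs a f) b) t = - poly (f (R (- t) b a)) (t - l)"
    unfolding Rs_def by (subst act) (simp_all only: 0 1 2)
qed

abbreviation "DB \<equiv> sprod double_scale double_bracket"

lemma double_bracket_eq: "double_bracket u v = map_poly (\<lambda>q. (q, 0)) (sum_product rt lt (fst u) (fst v)) +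
    map_poly (\<lambda>z. (0, z)) (Ls (fst u) (snd v) +
      flip dual_scale (- Ls (fst v) (snd u) - Rs (fst v) (snd u)))"
  by (simp add: double_bracket_def semidirect_bracket_def split: prod.split)

lemma fst_DB: "fst (DB l u v) = R l (fst u) (fst v) + L l (fst u) (fst v)"
  by (simp add: double_bracket_eq double_scale_def ev_pair[OF module_scale module_dual_scale] sprod_sum_product)

text \<open>
The dual component of the bracket of \<open>a+f\<close> and \<open>b+g\<close> in scalar form. The first term is
\<open>[a\<^sub>\<lambda> g]\<close>; the other two are
\<open>[f\<^sub>\<lambda> b] = (-L\<^sup>*(b) - R\<^sup>*(b))\<^sub>-\<^sub>\<lambda>\<^sub>-\<^sub>\<partial> f\<close>, where \<open>\<partial>\<close> acts on the dual by \<open>-t\<close>.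
\<close>

lemma snd_DB:
  assumes "u \<in> double" "v \<in> double"
  shows "poly (snd (DB l u v) c) t = - poly (snd v (L l (fst u) c)) (t - l) +
    poly (snd u (L (t - l) (fst v) c)) l + poly (snd u (R (- t) c (fst v))) l"
proof -
  have uv: "snd u \<in> conf_dual scale" "snd v \<in> conf_dual scale"
    using assms by (auto simp: double_def)
  note vs = vector_space_kscale[OF module_dual_scale]
  have "poly (ev (kscale dual_scale) l (flip dual_scale F) c) t =
      poly (ev (kscale dual_scale) (- l + t) F c) t" for F :: "('q \<Rightarrow> 'k poly) poly"
    using fibre_flip[OF module_dual_scale, where H = "\<lambda>f. poly (f c) t" and t = "- t"]
    by (simp add: additive_def dual_scale_def pcompose_pCons)
  then show ?thesis
    by (simp add: double_bracket_eq double_scale_def ev_pair[OF module_scale module_dual_scale] ev_add[OF vs]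
        ev_diff[OF vs] ev_minus[OF vs] poly_Ls poly_Rs uv)
qed

lemma coeff_double_bracket:
  assumes "u \<in> double" "v \<in> double"
  shows "coeff (double_bracket u v) n \<in> double"
proof -
  have uv: "snd u \<in> conf_dual scale" "snd v \<in> conf_dual scale"
    using assms by (auto simp: double_def)
  note sub = subspace_conf_dual[OF module_scale]
  have "coeff (flip dual_scale (- Ls (fst v) (snd u) - Rs (fst v) (snd u))) n \<in> conf_dual scale"
    by (rule coeff_flip_in_subspace[OF module_dual_scale sub])
      (simp add: module.subspace_diff[OF module_dual_scale sub]
        module.subspace_neg[OF module_dual_scale sub] coeff_Ls coeff_Rs uv)
  then show ?thesis
    by (simp add: double_bracket_eq double_def coeff_map_poly zero_prod_def coeff_Ls uv
        module.subspace_add[OF module_dual_scale sub])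
qed

lemma double_eqI:
  fixes x y :: "'q \<times> ('q \<Rightarrow> 'k poly)"
  assumes "fst x = fst y" "\<And>c t. poly (snd x c) t = poly (snd y c) t"
  shows "x = y"
proof (rule prod_eqI)
  show "snd x = snd y"
    by (rule ext, rule iffD1[OF poly_eq_poly_eq_iff]) (rule ext, rule assms)
qed (rule assms)

lemma double_scale: "fst (double_scale p u) = scale p (fst u)"
  "poly (snd (double_scale p u) c) t = poly p (- t) * poly (snd u c) t"
  by (simp_all add: double_scale_def sum_scale_def dual_scale_def poly_pcompose)

lemma double_fibre:
  assumes "u \<in> double"
  shows "poly (snd u (x + y)) t = poly (snd u x) t + poly (snd u y) t"
    "poly (snd u (scale p x)) t = poly p t * poly (snd u x) t"
    "poly (snd u (x - y)) t = poly (snd u x) t - poly (snd u y) t"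
    "poly (snd u (- x)) t = - poly (snd u x) t"
    "poly (snd u 0) t = 0"
proof -
  have u: "snd u \<in> conf_dual scale" using assms by (auto simp: double_def)
  note f = conf_dual_fibre[OF module_scale u]
  show "poly (snd u (x + y)) t = poly (snd u x) t + poly (snd u y) t"
    "poly (snd u (scale p x)) t = poly p t * poly (snd u x) t"
    "poly (snd u (x - y)) t = poly (snd u x) t - poly (snd u y) t"
    "poly (snd u (- x)) t = - poly (snd u x) t"
    "poly (snd u 0) t = 0"
    using f(1,2) additive.diff[OF f(3)] additive.minus[OF f(3)] additive.zero[OF f(3)] by blast+
qed

lemma double_closed:
  shows "u \<in> double \<Longrightarrow> v \<in> double \<Longrightarrow> u + v \<in> double" "u \<in> double \<Longrightarrow> double_scale p u \<in> double"
  using module.subspace_add[OF module_double_scale subspace_double]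
    module.subspace_scale[OF module_double_scale subspace_double] by blast+

lemma sesquilinear_DB: "sesquilinear double_scale double DB"
  unfolding sesquilinear_def
  by (intro conjI ballI allI double_eqI;
      simp add: fst_DB snd_DB double_scale double_closed lt_sesq rt_sesq double_fibre algebra_simps)

lemma lambda_product_double_bracket: "lambda_product double_scale double double_bracket"
  using lambda_product_iff[OF module_double_scale] coeff_double_bracket sesquilinear_DB by blast

lemma DB_in_double: "u \<in> double \<Longrightarrow> v \<in> double \<Longrightarrow> DB l u v \<in> double"
  by (rule ev_in_subspace[OF module_double_scale subspace_double coeff_double_bracket])

text \<open>
The component in \<open>Q\<close> is the sum of the three dendriform identities. In the dual component at the
point \<open>t\<close>, each of the three functionals contributes separately, and one uses the dendriform
identities with two of the scalars \<open>l\<close>, \<open>m\<close>, \<open>t-l-m\<close>, \<open>-t\<close> in place of the formal variables. The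
functional in the first argument leaves \<open>(c \<triangleright> e + e \<triangleleft> c) \<triangleright> b\<close> over, which is zero by \<open>R_left_cancel\<close>.
\<close>

lemma leibniz_DB:
  assumes P: "u \<in> double" "v \<in> double" "w \<in> double"
  shows "DB l u (DB m v w) = DB (l + m) (DB l u v) w + DB m v (DB l u w)"
proof (rule double_eqI)
  show "fst (DB l u (DB m v w)) = fst (DB (l + m) (DB l u v) w + DB m v (DB l u w))"
    using dendriform_scalar1[of l "fst u" m "fst v" "fst w"]
      dendriform_scalar2[of l "fst u" m "fst v" "fst w"]
      dendriform_scalar3[of l "fst u" m "fst v" "fst w"]
    by (simp add: fst_DB lt_sesq rt_sesq algebra_simps)
next
  fix c t
  let ?a = "fst u" and ?b = "fst v" and ?e = "fst w" and ?k = "t - l - m"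
  note lin = lt_sesq rt_sesq double_fibre P
  have w: "poly (snd w (L m ?b (L l ?a c))) ?k = poly (snd w (L l ?a (L m ?b c))) ?k
      - poly (snd w (L (l + m) (R l ?a ?b) c)) ?k - poly (snd w (L (l + m) (L l ?a ?b) c)) ?k"
    using arg_cong[OF dendriform_scalar3[of l ?a m ?b c], of "\<lambda>x. poly (snd w x) ?k"]
    by (simp add: lin)
  have v1: "poly (snd v (L l ?a (L ?k ?e c))) m = poly (snd v (L (t - m) (R l ?a ?e) c)) m
      + poly (snd v (L (t - m) (L l ?a ?e) c)) m + poly (snd v (L ?k ?e (L l ?a c))) m"
    using dendriform_scalar3[of l ?a ?k ?e c] by (simp add: lin)
  have v2: "poly (snd v (L l ?a (R (- t) c ?e))) m = poly (snd v (R (l - t) (L l ?a c) ?e)) m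
      + poly (snd v (R (- t) c (R l ?a ?e))) m + poly (snd v (R (- t) c (L l ?a ?e))) m"
    using dendriform_scalar2[of l ?a "- t" c ?e] by (simp add: lin)
  have u1: "poly (snd u (L m ?b (L ?k ?e c))) l = poly (snd u (L (t - l) (R m ?b ?e) c)) l
      + poly (snd u (L (t - l) (L m ?b ?e) c)) l + poly (snd u (L ?k ?e (L m ?b c))) l"
    using dendriform_scalar3[of m ?b ?k ?e c] by (simp add: lin)
  have u2: "poly (snd u (L m ?b (R (- t) c ?e))) l = poly (snd u (R (m - t) (L m ?b c) ?e)) l
      + poly (snd u (R (- t) c (R m ?b ?e))) l + poly (snd u (R (- t) c (L m ?b ?e))) l"
    using dendriform_scalar2[of m ?b "- t" c ?e] by (simp add: lin)
  have u3: "poly (snd u (R (- l - m) (L ?k ?e c) ?b)) l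
      + poly (snd u (R (- l - m) (R (- t) c ?e) ?b)) l = 0"
    using arg_cong[OF R_left_cancel[of "- t" ?k c ?e ?b], of "\<lambda>x. poly (snd u x) l"]
    by (simp add: lin add.commute)
  have sub: "t - (l + m) = ?k" "t - m - l = ?k" "- (t - l) = l - t" "- (t - m) = m - t"
    "- (l + m) = - l - m"
    by (simp_all add: algebra_simps)
  show "poly (snd (DB l u (DB m v w)) c) t =
      poly (snd (DB (l + m) (DB l u v) w + DB m v (DB l u w)) c) t"
    unfolding plus_fun_apply snd_add poly_add fst_DB snd_DB[OF P(1) DB_in_double[OF P(2,3)]]
      snd_DB[OF DB_in_double[OF P(1,2)] P(3)] snd_DB[OF P(2) DB_in_double[OF P(1,3)]]
      snd_DB[OF P(1,2)] snd_DB[OF P(1,3)] snd_DB[OF P(2,3)] lin sub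
    using w v1 v2 u1 u2 u3 by (simp add: lin sub)
qed

theorem leibniz_double: "leibniz_conformal_algebra double_scale double double_bracket"
  unfolding leibniz_conformal_algebra_def
  by (intro conjI ballI iffD2[OF nested_identity_iff[OF module_double_scale subspace_double]]
      allI leibniz_DB module_double_scale subspace_double lambda_product_double_bracket)

end


section \<open>Linear functionals on formal tensors\<close>

lemma lookup_fscale: "Poly_Mapping.lookup (fscale c t) xs = c * Poly_Mapping.lookup t xs"
  by (simp add: fscale_def Poly_Mapping.map.rep_eq when_def)

lemma vector_space_fscale: "vector_space (fscale :: 'k::field \<Rightarrow> ('p list \<Rightarrow>\<^sub>0 'k) \<Rightarrow> _)"
  by unfold_locales (auto intro!: poly_mapping_eqI simp: lookup_fscale lookup_add algebra_simps)

lemma module_fscale: "module (fscale :: 'k::field \<Rightarrow> ('p list \<Rightarrow>\<^sub>0 'k) \<Rightarrow> _)"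
  using vector_space_fscale by (simp add: module_iff_vector_space)

definition linear_extension :: "('p list \<Rightarrow> 'k::field) \<Rightarrow> ('p list \<Rightarrow>\<^sub>0 'k) \<Rightarrow> 'k"
  where "linear_extension g t = (\<Sum>xs\<in>Poly_Mapping.keys t. Poly_Mapping.lookup t xs * g xs)"

lemma lin_superset:
  assumes "finite A" "Poly_Mapping.keys t \<subseteq> A"
  shows "linear_extension g t = (\<Sum>xs\<in>A. Poly_Mapping.lookup t xs * g xs)"
  unfolding linear_extension_def by (rule sum.mono_neutral_left) (use assms in \<open>auto simp: in_keys_iff\<close>)

lemma additive_lin: "additive (linear_extension g)"
proof (rule additive.intro)
  fix t t' :: "'a list \<Rightarrow>\<^sub>0 'b"
  let ?A = "Poly_Mapping.keys t \<union> Poly_Mapping.keys t'"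
  have "Poly_Mapping.keys (t + t') \<subseteq> ?A" by (rule Poly_Mapping.keys_add)
  then show "linear_extension g (t + t') = linear_extension g t + linear_extension g t'"
    by (subst (1 2 3) lin_superset[of ?A]) (auto simp: lookup_add algebra_simps sum.distrib)
qed

lemma lin_single: "linear_extension g (Poly_Mapping.single xs c) = c * g xs"
  by (cases "c = 0") (simp_all add: linear_extension_def)

lemma lin_pure: "linear_extension g (pure xs) = g xs"
  by (simp add: pure_def lin_single)

lemma lin_fscale: "linear_extension g (fscale c t) = c * linear_extension g t"
proof -
  have "Poly_Mapping.keys (fscale c t) \<subseteq> Poly_Mapping.keys t"
    by (auto simp: in_keys_iff lookup_fscale)
  then show ?thesis
    by (subst lin_superset[of "Poly_Mapping.keys t"])
      (simp_all add: linear_extension_def lookup_fscale sum_distrib_left mult.assoc)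
qed

lemma functional_eq_lin:
  assumes "additive \<phi>" "\<And>c t. \<phi> (fscale c t) = c * \<phi> t"
  shows "\<phi> t = linear_extension (\<lambda>xs. \<phi> (pure xs)) t"
proof -
  have "t = (\<Sum>xs\<in>Poly_Mapping.keys t. fscale (Poly_Mapping.lookup t xs) (pure xs))"
  proof (rule poly_mapping_eqI)
    fix ys
    have "(\<Sum>xs\<in>Poly_Mapping.keys t. Poly_Mapping.lookup t xs * (1 when xs = ys)) =
        (\<Sum>xs\<in>Poly_Mapping.keys t. if xs = ys then Poly_Mapping.lookup t ys else 0)"
      by (rule sum.cong) (auto simp: when_def)
    then show "Poly_Mapping.lookup t ys = Poly_Mapping.lookup
        (\<Sum>xs\<in>Poly_Mapping.keys t. fscale (Poly_Mapping.lookup t xs) (pure xs)) ys"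
      by (simp add: lookup_sum lookup_fscale pure_def lookup_single in_keys_iff)
  qed
  then have "\<phi> t = \<phi> (\<Sum>xs\<in>Poly_Mapping.keys t. fscale (Poly_Mapping.lookup t xs) (pure xs))"
    by simp
  then show ?thesis by (simp add: additive.sum[OF assms(1)] assms(2) linear_extension_def)
qed

lemma tensor_del_superset:
  assumes "finite A" "Poly_Mapping.keys t \<subseteq> A"
  shows "tensor_del s i t =
    (\<Sum>xs\<in>A. Poly_Mapping.single (xs[i := del s (xs ! i)]) (Poly_Mapping.lookup t xs))"
  unfolding tensor_del_def
  by (rule sum.mono_neutral_left) (use assms in \<open>auto simp: in_keys_iff\<close>)

lemma tensor_del_add: "tensor_del s i (t + t') = tensor_del s i t + tensor_del s i t'"
proof -
  let ?A = "Poly_Mapping.keys t \<union> Poly_Mapping.keys t'"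
  have "Poly_Mapping.keys (t + t') \<subseteq> ?A" by (rule Poly_Mapping.keys_add)
  then show ?thesis
    by (subst (1 2 3) tensor_del_superset[of ?A]) (auto simp: lookup_add single_add sum.distrib)
qed

lemma fscale_single: "fscale c (Poly_Mapping.single xs d) = Poly_Mapping.single xs (c * d)"
  by (rule poly_mapping_eqI) (simp add: lookup_fscale lookup_single when_def)

lemma tensor_del_fscale: "tensor_del s i (fscale c t) = fscale c (tensor_del s i t)"
proof -
  have "Poly_Mapping.keys (fscale c t) \<subseteq> Poly_Mapping.keys t"
    by (auto simp: in_keys_iff lookup_fscale)
  then show ?thesis
    by (subst tensor_del_superset[of "Poly_Mapping.keys t"])
      (simp_all add: tensor_del_def lookup_fscale
        additive.sum[OF additive_scale[OF vector_space_fscale]] fscale_single)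
qed

lemma tensor_del_pure: "tensor_del s i (pure xs) = pure (xs[i := del s (xs ! i)])"
  by (simp add: tensor_del_def pure_def)

lemma lin_tensor_del:
  assumes "\<And>xs. g (xs[i := del s (xs ! i)]) = \<kappa> * g xs"
  shows "linear_extension g (tensor_del s i t) = \<kappa> * linear_extension g t"
proof -
  have "linear_extension g (tensor_del s i t) =
      (\<Sum>xs\<in>Poly_Mapping.keys t. Poly_Mapping.lookup t xs * (\<kappa> * g xs))"
    by (simp add: tensor_del_def additive.sum[OF additive_lin] lin_single assms)
  then show ?thesis by (simp add: linear_extension_def sum_distrib_left mult.left_commute)
qed

lemma subspace_formal_tensors: "module.subspace fscale (formal_tensors P n)"
  unfolding module.subspace_def[OF module_fscale] formal_tensors_def
  by (auto simp: in_keys_iff lookup_fscale lookup_add subset_iff) (metis add.right_neutral)+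

lemma pure_in_formal_tensors:
  "length xs = n \<Longrightarrow> set xs \<subseteq> P \<Longrightarrow> pure xs \<in> formal_tensors P n"
  by (simp add: formal_tensors_def pure_def)

lemma sum_in_subspace:
  "module s \<Longrightarrow> module.subspace s V \<Longrightarrow> (\<And>i. i \<in> A \<Longrightarrow> f i \<in> V) \<Longrightarrow> sum f A \<in> V"
  using module.subspace_sum by blast

lemma single_in_formal_tensors:
  "length xs = n \<Longrightarrow> set xs \<subseteq> P \<Longrightarrow> Poly_Mapping.single xs c \<in> formal_tensors P n"
  by (cases "c = 0") (simp_all add: formal_tensors_def)

lemma tensor_del_in_formal_tensors:
  assumes "\<And>u. u \<in> P \<Longrightarrow> del s u \<in> P" "t \<in> formal_tensors P n"
  shows "tensor_del s i t \<in> formal_tensors P n"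
  unfolding tensor_del_def
proof (rule sum_in_subspace[OF module_fscale subspace_formal_tensors])
  fix xs assume "xs \<in> Poly_Mapping.keys t"
  then have xs: "length xs = n" "set xs \<subseteq> P" using assms(2) by (auto simp: formal_tensors_def)
  have "set (xs[i := del s (xs ! i)]) \<subseteq> P"
  proof (cases "i < length xs")
    case True
    then show ?thesis
      using xs(2) assms(1)[of "xs ! i"] set_update_subset_insert[of xs i] nth_mem[OF True] by blast
  qed (use xs in \<open>simp add: list_update_beyond\<close>)
  with xs show "Poly_Mapping.single (xs[i := del s (xs ! i)]) (Poly_Mapping.lookup t xs) \<in> formal_tensors P n"
    by (simp add: single_in_formal_tensors)
qed

lemma tensor_class_eq_iff:
  "tensor_class s P n t = tensor_class s P n t' \<longleftrightarrow>
    t - t' \<in> module.span fscale (tensor_relations s P n)"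
proof -
  let ?V = "module.span fscale (tensor_relations s P n)"
  note diff = module.span_diff[OF module_fscale, of _ "tensor_relations s P n"]
  show ?thesis
  proof
    assume eq: "tensor_class s P n t = tensor_class s P n t'"
    have "t \<in> tensor_class s P n t"
      by (simp add: tensor_class_def module.span_zero[OF module_fscale])
    then show "t - t' \<in> ?V" by (simp add: eq) (simp add: tensor_class_def)
  next
    assume d: "t - t' \<in> ?V"
    have "y - t \<in> ?V \<longleftrightarrow> y - t' \<in> ?V" for y
      using module.span_add[OF module_fscale _ d, of "y - t"] diff[OF _ d, of "y - t'"] by auto
    then show "tensor_class s P n t = tensor_class s P n t'" by (simp add: tensor_class_def)
  qed
qed

section \<open>Trilinear forms invariant under the derivation\<close>

text \<open>
The polynomial \<open>p(x) q(y) r(-x-y)\<close>, with outer variable \<open>y\<close>. It represents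
\<open>p(\<partial>)u \<otimes> q(\<partial>)v \<otimes> r(\<partial>)w\<close> modulo the image of \<open>\<partial>\<^sub>1+\<partial>\<^sub>2+\<partial>\<^sub>3\<close>, where \<open>\<partial>\<^sub>3\<close> can be eliminated.
\<close>

definition tripoly :: "'k::field poly \<Rightarrow> 'k poly \<Rightarrow> 'k poly \<Rightarrow> 'k poly poly"
  where "tripoly p q r =
    [:p:] * map_poly (\<lambda>c. [:c:]) q * pcompose (map_poly (\<lambda>c. [:c:]) r) [:[:0, -1:], -1:]"

lemma poly_poly_tripoly: "poly (poly (tripoly p q r) [:y:]) x = poly p x * poly q y * poly r (- x - y)"
proof -
  have "poly (map_poly (\<lambda>c. [:c:]) q) r = pcompose q r" for q r :: "'a poly"
    by (induction q) (auto simp: map_poly_pCons pcompose_pCons)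
  then show ?thesis by (simp add: tripoly_def poly_pcompose minus_diff_commute)
qed

lemma tripoly_pCons:
  fixes p q r :: "'k::field_char_0 poly"
  shows "tripoly p q (pCons c r) =
    tripoly (smult c p) q 1 - tripoly (pCons 0 p) q r - tripoly p (pCons 0 q) r"
  by (rule poly_poly_eqI) (simp add: poly_poly_tripoly algebra_simps)

lemma additive_on_sum:
  assumes "module s" "module.subspace s P" and "\<And>u v. u \<in> P \<Longrightarrow> v \<in> P \<Longrightarrow> h (u + v) = h u + (h v :: 'b::ab_group_add)"
    and "\<And>i. i \<in> A \<Longrightarrow> f i \<in> P"
  shows "h (\<Sum>i\<in>A. f i) = (\<Sum>i\<in>A. h (f i))"
proof -
  have "h 0 = 0" using assms(3)[of 0 0] module.subspace_0[OF assms(1,2)] by simp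
  with assms(4) show ?thesis
    by (induction A rule: infinite_finite_induct)
      (auto simp: assms(3) sum_in_subspace[OF assms(1,2)])
qed

locale invariant_trilinear =
  fixes s :: "'k::field_char_0 poly \<Rightarrow> 'p::ab_group_add \<Rightarrow> 'p" and P :: "'p set"
    and T :: "'p \<Rightarrow> 'p \<Rightarrow> 'p \<Rightarrow> 'k"
  assumes module_s: "module s" and subspace_P: "module.subspace s P"
    and T_add: "\<lbrakk>u \<in> P; u' \<in> P; v \<in> P; w \<in> P\<rbrakk> \<Longrightarrow> T (u + u') v w = T u v w + T u' v w"
      "\<lbrakk>u \<in> P; u' \<in> P; v \<in> P; w \<in> P\<rbrakk> \<Longrightarrow> T v (u + u') w = T v u w + T v u' w"
      "\<lbrakk>u \<in> P; u' \<in> P; v \<in> P; w \<in> P\<rbrakk> \<Longrightarrow> T v w (u + u') = T v w u + T v w u'"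
    and T_scale: "\<lbrakk>u \<in> P; v \<in> P; w \<in> P\<rbrakk> \<Longrightarrow> T (kscale s c u) v w = c * T u v w"
      "\<lbrakk>u \<in> P; v \<in> P; w \<in> P\<rbrakk> \<Longrightarrow> T u (kscale s c v) w = c * T u v w"
      "\<lbrakk>u \<in> P; v \<in> P; w \<in> P\<rbrakk> \<Longrightarrow> T u v (kscale s c w) = c * T u v w"
    and T_del: "\<lbrakk>u \<in> P; v \<in> P; w \<in> P\<rbrakk> \<Longrightarrow> T (del s u) v w + T u (del s v) w + T u v (del s w) = 0"
begin

text \<open>
The linear functional on \<open>k[x,y]\<close> with \<open>x\<^sup>a y\<^sup>b \<mapsto> T(\<partial>\<^sup>a u, \<partial>\<^sup>b v, w)\<close>.
\<close>

definition coefficient_functional :: "'p \<Rightarrow> 'p \<Rightarrow> 'p \<Rightarrow> 'k poly poly \<Rightarrow> 'k"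
  where "coefficient_functional u v w G =
    (\<Sum>b\<le>degree G. T (s (coeff G b) u) ((del s ^^ b) v) w)"

lemma scale_in_P: "u \<in> P \<Longrightarrow> s p u \<in> P"
  using module.subspace_scale[OF module_s subspace_P] .

lemma del_funpow_in_P: "u \<in> P \<Longrightarrow> (del s ^^ b) u \<in> P"
  by (induction b) (auto simp: scale_in_P)

lemma smult_scale: "s (smult c p) u = kscale s c (s p u)"
  by (simp add: module.scale_scale[OF module_s])

context
  fixes u v w assumes P: "u \<in> P" "v \<in> P" "w \<in> P"
begin

lemma additive_coefficient_functional: "additive (coefficient_functional u v w)"
  unfolding coefficient_functional_def
  by (rule additive.intro, rule sum_coeff_add)
    (simp add: module.scale_left_distrib[OF module_s] T_add scale_in_P del_funpow_in_P P)

lemma coefficient_functional_scale: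
  "coefficient_functional u v w (smult [:c:] G) = c * coefficient_functional u v w G"
proof -
  have 0: "T (s 0 u) ((del s ^^ b) v) w = 0" for b
    using T_scale(1)[OF P(1) del_funpow_in_P[OF P(2), of b] P(3), of 0] by simp
  have "coefficient_functional u v w (smult [:c:] G) =
      (\<Sum>b\<le>degree G. T (s (coeff (smult [:c:] G) b) u) ((del s ^^ b) v) w)"
    unfolding coefficient_functional_def
    by (rule sum_coeff_extend) (auto simp: 0 degree_smult_le)
  then show ?thesis
    by (simp add: coefficient_functional_def smult_scale T_scale scale_in_P del_funpow_in_P P
        sum_distrib_left)
qed

text \<open>
Induction on \<open>r\<close>: invariance moves each \<open>\<partial>\<close> from the third argument to the first two, which is
multiplication by \<open>-x-y\<close> on the side of polynomials.
\<close>

lemma T_eq_coefficient_functional: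
  "T (s p u) (s q v) (s r w) = coefficient_functional u v w (tripoly p q r)"
proof (induction r arbitrary: p q)
  case 0
  have "tripoly p q 0 = 0" by (simp add: tripoly_def)
  moreover have "T (s p u) (s q v) (s 0 w) = 0"
    using T_scale(3)[OF scale_in_P[OF P(1), of p] scale_in_P[OF P(2), of q] P(3), of 0] by simp
  ultimately show ?case
    using additive.zero[OF additive_coefficient_functional] by simp
next
  case (pCons c r)
  have base: "T (s p u) (s q v) w = coefficient_functional u v w (tripoly p q 1)" for p q
  proof -
    have 0: "T (s 0 u) ((del s ^^ b) v) w = 0" for b
      using T_scale(1)[OF P(1) del_funpow_in_P[OF P(2), of b] P(3), of 0] by simp
    have iter: "(del s ^^ b) (kscale s d v) = kscale s d ((del s ^^ b) v)" for b d
      by (induction b) (simp_all add: kscale_commute[OF module_s])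
    have "T (s p u) (s q v) w = T (s p u) (\<Sum>b\<le>degree q. kscale s (coeff q b) ((del s ^^ b) v)) w"
      by (simp add: scale_eq_psubst[OF module_s, of q] psubst_def iter)
    also have "\<dots> = (\<Sum>b\<le>degree q. T (s p u) (kscale s (coeff q b) ((del s ^^ b) v)) w)"
      by (rule additive_on_sum[OF module_s subspace_P, where h = "\<lambda>x. T (s p u) x w"])
        (auto simp: T_add scale_in_P del_funpow_in_P P)
    also have "\<dots> = (\<Sum>b\<le>degree q. T (s (coeff (tripoly p q 1) b) u) ((del s ^^ b) v) w)"
      by (simp add: tripoly_def coeff_map_poly pcompose_1 smult_scale mult.commute[of p]
          T_scale scale_in_P del_funpow_in_P P)
    also have "\<dots> = coefficient_functional u v w (tripoly p q 1)"
      unfolding coefficient_functional_def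
      by (rule sum_coeff_extend[symmetric])
        (auto simp: 0 tripoly_def pcompose_1 intro: order_trans[OF degree_smult_le] map_poly_degree_leq)
    finally show ?thesis .
  qed
  have comp: "del s (s p x) = s (pCons 0 p) x" for p x
    by (simp add: module.scale_scale[OF module_s])
  have "T (s p u) (s q v) (s (pCons c r) w) =
      c * T (s p u) (s q v) w + T (s p u) (s q v) (del s (s r w))"
    by (simp add: scale_pCons[OF module_s, of c r] T_add T_scale scale_in_P P)
  also have "\<dots> = T (s (smult c p) u) (s q v) w
      - T (s (pCons 0 p) u) (s q v) (s r w) - T (s p u) (s (pCons 0 q) v) (s r w)"
  proof -
    have "T (del s (s p u)) (s q v) (s r w) + T (s p u) (del s (s q v)) (s r w)
        + T (s p u) (s q v) (del s (s r w)) = 0"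
      by (rule T_del) (simp_all only: scale_in_P P)
    then have "T (s p u) (s q v) (del s (s r w)) =
        - T (s (pCons 0 p) u) (s q v) (s r w) - T (s p u) (s (pCons 0 q) v) (s r w)"
      unfolding comp by (simp add: eq_diff_eq eq_neg_iff_add_eq_0 ac_simps)
    then show ?thesis by (simp add: smult_scale T_scale scale_in_P P)
  qed
  also have "\<dots> = coefficient_functional u v w (tripoly p q (pCons c r))"
    by (simp add: base pCons.IH tripoly_pCons additive.diff[OF additive_coefficient_functional])
  finally show ?case .
qed

end

end


section \<open>The Yang-Baxter equation for the tensor of a perfect pairing\<close>

text \<open>
A conformal pairing \<open>pr\<close> on \<open>P\<close>, symmetric in the conformal sense \<open>(v,u)\<^sub>x = (u,v)\<^sub>-\<^sub>x\<close>, together with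
dual families \<open>e\<close>, \<open>e'\<close>. For \<open>w \<in> P\<close> the functional \<open>\<phi> w x\<close> lives in the fibre at \<open>x\<close>.
\<close>

locale perfect_pairing =
  fixes s :: "'k::field_char_0 poly \<Rightarrow> 'p::ab_group_add \<Rightarrow> 'p" and P :: "'p set"
    and pr :: "'p \<Rightarrow> 'p \<Rightarrow> 'k poly" and I :: "'i set" and e e' :: "'i \<Rightarrow> 'p"
  assumes module_s: "module s" and subspace_P: "module.subspace s P"
    and pr_add: "w \<in> P \<Longrightarrow> pr w (u + v) = pr w u + pr w v"
    and pr_scale: "w \<in> P \<Longrightarrow> pr w (s p u) = p * pr w u"
    and pr_sym: "pr v u = pcompose (pr u v) [:0, -1:]"
    and finite_I: "finite I" and e_in_P: "i \<in> I \<Longrightarrow> e i \<in> P" "i \<in> I \<Longrightarrow> e' i \<in> P"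
    and expand: "u \<in> P \<Longrightarrow> (\<Sum>i\<in>I. s (pr (e' i) u) (e i)) = u"
      "u \<in> P \<Longrightarrow> (\<Sum>i\<in>I. s (pr (e i) u) (e' i)) = u"
begin

abbreviation \<phi> :: "'p \<Rightarrow> 'k \<Rightarrow> 'p \<Rightarrow> 'k" where "\<phi> w x u \<equiv> poly (pr w u) x"

definition casimir :: "'p list \<Rightarrow>\<^sub>0 'k" where "casimir = (\<Sum>i\<in>I. pure [e i, e' i])"

lemma scale_in_P: "u \<in> P \<Longrightarrow> s p u \<in> P"
  using module.subspace_scale[OF module_s subspace_P] .

lemma \<phi>_add: "w \<in> P \<Longrightarrow> \<phi> w x (u + v) = \<phi> w x u + \<phi> w x v"
  by (simp add: pr_add)

lemma \<phi>_scale: "w \<in> P \<Longrightarrow> \<phi> w x (s p u) = poly p x * \<phi> w x u"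
  by (simp add: pr_scale)

lemma \<phi>_sym: "\<phi> v x u = \<phi> u (- x) v"
  by (subst pr_sym) (simp add: poly_pcompose)

lemma \<phi>_minus: "w \<in> P \<Longrightarrow> \<phi> w x (- u) = - \<phi> w x u"
  using \<phi>_add[where u = "- u" and v = u] \<phi>_scale[where p = 0 and u = u]
  by (simp add: module.scale_zero_left[OF module_s] eq_neg_iff_add_eq_0)

definition fibre :: "'k \<Rightarrow> ('p \<Rightarrow> 'k) \<Rightarrow> bool" where
  "fibre t H \<longleftrightarrow> (\<forall>u\<in>P. \<forall>v\<in>P. H (u + v) = H u + H v) \<and>
    (\<forall>u\<in>P. \<forall>c. H (kscale s c u) = c * H u) \<and> (\<forall>u\<in>P. H (del s u) = t * H u)"

text \<open>
Expanding \<open>w\<close> in one of the dual families and applying \<open>H\<close> gives the coefficients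
\<open>(e\<^sub>i,w)\<^sub>-\<^sub>x = (w,e\<^sub>i)\<^sub>x\<close>; here it matters that \<open>H\<close> lives in the fibre opposite to \<open>x\<close>.
\<close>

lemma contract_casimir:
  assumes H: "fibre (- x) H" and w: "w \<in> P"
  shows "(\<Sum>i\<in>I. \<phi> w x (e i) * H (e' i)) = H w"
    and "(\<Sum>i\<in>I. \<phi> w x (e' i) * H (e i)) = H w"
proof -
  have sc: "H (s p u) = poly p (- x) * H u" if "u \<in> P" for p u
    by (rule fibre_scale[OF module_s subspace_P]) (use H that in \<open>auto simp: fibre_def\<close>)
  have H_add: "H (u + v) = H u + H v" if "u \<in> P" "v \<in> P" for u v
    using H that by (simp add: fibre_def)
  note H_sum = additive_on_sum[OF module_s subspace_P H_add]
  have "H (\<Sum>i\<in>I. s (pr (e i) w) (e' i)) = (\<Sum>i\<in>I. \<phi> w x (e i) * H (e' i))"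
    by (subst H_sum) (auto simp: sc e_in_P scale_in_P \<phi>_sym[of w] intro!: sum.cong)
  then show "(\<Sum>i\<in>I. \<phi> w x (e i) * H (e' i)) = H w" by (simp add: expand w)
  have "H (\<Sum>i\<in>I. s (pr (e' i) w) (e i)) = (\<Sum>i\<in>I. \<phi> w x (e' i) * H (e i))"
    by (subst H_sum) (auto simp: sc e_in_P scale_in_P \<phi>_sym[of w] intro!: sum.cong)
  then show "(\<Sum>i\<in>I. \<phi> w x (e' i) * H (e i)) = H w" by (simp add: expand w)
qed

text \<open>
The universal property of \<open>P \<otimes> P\<close>. It makes the contractions below independent of the presentation
of the tensor as a sum of pure tensors.
\<close>

lemma bilinear_on_tensor_square:
  fixes \<beta> :: "'p \<Rightarrow> 'p \<Rightarrow> 'k"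
  assumes \<beta>: "\<And>u u' v. \<lbrakk>u \<in> P; u' \<in> P; v \<in> P\<rbrakk> \<Longrightarrow> \<beta> (u + u') v = \<beta> u v + \<beta> u' v"
      "\<And>u v v'. \<lbrakk>u \<in> P; v \<in> P; v' \<in> P\<rbrakk> \<Longrightarrow> \<beta> u (v + v') = \<beta> u v + \<beta> u v'"
      "\<And>c u v. \<lbrakk>u \<in> P; v \<in> P\<rbrakk> \<Longrightarrow> \<beta> (kscale s c u) v = c * \<beta> u v"
      "\<And>c u v. \<lbrakk>u \<in> P; v \<in> P\<rbrakk> \<Longrightarrow> \<beta> u (kscale s c v) = c * \<beta> u v"
    and eq: "tensor_class s P 2 t = tensor_class s P 2 t'"
  shows "linear_extension (\<lambda>xs. \<beta> (xs ! 0) (xs ! 1)) t = linear_extension (\<lambda>xs. \<beta> (xs ! 0) (xs ! 1)) t'"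
proof -
  let ?h = "linear_extension (\<lambda>xs. \<beta> (xs ! 0) (xs ! 1)) :: ('p list \<Rightarrow>\<^sub>0 'k) \<Rightarrow> 'k"
  note h = additive.add[OF additive_lin] additive.diff[OF additive_lin] lin_pure lin_fscale
    additive.zero[OF additive_lin]
  have split2: "us = [] \<and> (\<exists>v. vs = [v]) \<or> (\<exists>u. us = [u]) \<and> vs = []"
    if "length us + 1 + length vs = 2" for us vs :: "'p list"
    using that by (cases us; cases vs) auto
  have add: "\<beta> ((us @ (x + y) # vs) ! 0) ((us @ (x + y) # vs) ! 1) =
      \<beta> ((us @ x # vs) ! 0) ((us @ x # vs) ! 1) + \<beta> ((us @ y # vs) ! 0) ((us @ y # vs) ! 1)"
    if "x \<in> P" "y \<in> P" "set us \<subseteq> P" "set vs \<subseteq> P" "length us + 1 + length vs = 2" for us vs x y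
    using split2[OF that(5)] that(1-4) by (auto simp: \<beta>)
  have scale: "\<beta> ((us @ kscale s a x # vs) ! 0) ((us @ kscale s a x # vs) ! 1) =
      a * \<beta> ((us @ x # vs) ! 0) ((us @ x # vs) ! 1)"
    if "x \<in> P" "set us \<subseteq> P" "set vs \<subseteq> P" "length us + 1 + length vs = 2" for us vs a x
    using split2[OF that(4)] that(1-3) by (auto simp: \<beta>)
  have "tensor_relations s P 2 \<subseteq> {t. ?h t = 0}"
    unfolding tensor_relations_def
    by (intro subsetI CollectI; elim UnE CollectE exE conjE; simp only: h add scale) simp_all
  moreover have "module.subspace fscale {t. ?h t = 0}"
    by (auto simp: module.subspace_def[OF module_fscale] h)
  ultimately have "module.span fscale (tensor_relations s P 2) \<subseteq> {t. ?h t = 0}"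
    by (intro module.span_minimal[OF module_fscale])
  with eq show ?thesis by (auto simp: tensor_class_eq_iff h)
qed

context
  fixes m :: nat and c d :: "nat \<Rightarrow> 'p"
  assumes cd: "\<And>i. i < m \<Longrightarrow> c i \<in> P" "\<And>i. i < m \<Longrightarrow> d i \<in> P"
    and presentation: "tensor_class s P 2 casimir = tensor_class s P 2 (\<Sum>i<m. pure [c i, d i])"
begin

lemma contract:
  assumes H: "fibre (- x) H" and w: "w \<in> P"
  shows "(\<Sum>i<m. \<phi> w x (c i) * H (d i)) = H w"
    and "(\<Sum>i<m. H (c i) * \<phi> w x (d i)) = H w"
proof -
  note lins = additive.sum[OF additive_lin] lin_pure
  have "linear_extension (\<lambda>xs. \<phi> w x (xs ! 0) * H (xs ! 1)) casimir =
      linear_extension (\<lambda>xs. \<phi> w x (xs ! 0) * H (xs ! 1)) (\<Sum>i<m. pure [c i, d i])"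
    by (rule bilinear_on_tensor_square[OF _ _ _ _ presentation])
      (use H w in \<open>auto simp: fibre_def \<phi>_add \<phi>_scale algebra_simps\<close>)
  with contract_casimir(1)[OF H w] show "(\<Sum>i<m. \<phi> w x (c i) * H (d i)) = H w"
    by (simp add: casimir_def lins)
  have "linear_extension (\<lambda>xs. H (xs ! 0) * \<phi> w x (xs ! 1)) casimir =
      linear_extension (\<lambda>xs. H (xs ! 0) * \<phi> w x (xs ! 1)) (\<Sum>i<m. pure [c i, d i])"
    by (rule bilinear_on_tensor_square[OF _ _ _ _ presentation])
      (use H w in \<open>auto simp: fibre_def \<phi>_add \<phi>_scale algebra_simps\<close>)
  with contract_casimir(2)[OF H w] show "(\<Sum>i<m. H (c i) * \<phi> w x (d i)) = H w"
    by (simp add: casimir_def lins mult.commute)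
qed

end

text \<open>
The value on lists of other lengths is zero so that \<open>\<partial>\<^sub>1\<close> and \<open>\<partial>\<^sub>2\<close> act by \<open>x\<close> and \<open>y\<close> on every
formal combination of lists.
\<close>

definition eval3 :: "'p \<Rightarrow> 'p \<Rightarrow> 'p \<Rightarrow> 'k \<Rightarrow> 'k \<Rightarrow> 'k \<Rightarrow> 'p list \<Rightarrow> 'k" where
  "eval3 w1 w2 w3 x y z xs =
    (if length xs = 3 then \<phi> w1 x (xs ! 0) * \<phi> w2 y (xs ! 1) * \<phi> w3 z (xs ! 2) else 0)"

lemma eval3_tensor_del:
  assumes "w1 \<in> P" "w2 \<in> P" "w3 \<in> P"
  shows "linear_extension (eval3 w1 w2 w3 x y z) (tensor_del s 0 t) = x * linear_extension (eval3 w1 w2 w3 x y z) t"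
    and "linear_extension (eval3 w1 w2 w3 x y z) (tensor_del s 1 t) = y * linear_extension (eval3 w1 w2 w3 x y z) t"
  by (rule lin_tensor_del; simp add: eval3_def \<phi>_scale assms)+

lemma span_relations_subset:
  "tensor_relations s P n \<subseteq> module.span fscale (tensor_relations s P n)"
  using module.span_base[OF module_fscale] by blast

text \<open>
Representatives of the image of \<open>\<partial>\<^sub>1+\<partial>\<^sub>2+\<partial>\<^sub>3\<close>, as a subspace of the free vector space. Linear
functionals vanishing on it restrict to trilinear forms \<open>T\<close> on \<open>P\<close> with
\<open>T(\<partial>u,v,w) + T(u,\<partial>v,w) + T(u,v,\<partial>w) = 0\<close>.
\<close>

definition null_tensors :: "('p list \<Rightarrow>\<^sub>0 'k) set" where
  "null_tensors = {t. \<exists>t'\<in>formal_tensors P 3.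
    t - (\<Sum>i<3. tensor_del s i t') \<in> module.span fscale (tensor_relations s P 3)}"

lemma null_tensors_iff: "t \<in> null_tensors \<longleftrightarrow> tensor_class s P 3 t \<in> total_del_image s P 3"
  by (auto simp: null_tensors_def total_del_image_def tensor_class_eq_iff)

lemma subspace_null_tensors: "module.subspace fscale null_tensors"
proof -
  let ?V = "module.span fscale (tensor_relations s P 3)"
  let ?D = "\<lambda>t. \<Sum>i<3. tensor_del s i t"
  note formal = subspace_formal_tensors[of P 3]
  have D: "?D (t + t') = ?D t + ?D t'" "?D (fscale a t) = fscale a (?D t)" for t t' a
    by (simp_all add: tensor_del_add tensor_del_fscale sum.distrib
        additive.sum[OF additive_scale[OF vector_space_fscale]])
  have "0 \<in> null_tensors"
    unfolding null_tensors_def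
    by (auto intro!: bexI[of _ 0] simp: tensor_del_def module.span_zero[OF module_fscale]
        module.subspace_0[OF module_fscale formal])
  moreover have "t + u \<in> null_tensors" if "t \<in> null_tensors" "u \<in> null_tensors" for t u
  proof -
    obtain t' u' where "t' \<in> formal_tensors P 3" "u' \<in> formal_tensors P 3"
      "t - ?D t' \<in> ?V" "u - ?D u' \<in> ?V"
      using \<open>t \<in> null_tensors\<close> \<open>u \<in> null_tensors\<close> unfolding null_tensors_def by blast
    then have "t' + u' \<in> formal_tensors P 3" "t + u - ?D (t' + u') \<in> ?V"
      using module.span_add[OF module_fscale, of "t - ?D t'" _ "u - ?D u'"]
        module.subspace_add[OF module_fscale formal]
      by (auto simp only: D add_diff_add)
    then show ?thesis unfolding null_tensors_def by blast
  qed
  moreover have "fscale a t \<in> null_tensors" if "t \<in> null_tensors" for a t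
  proof -
    obtain t' where "t' \<in> formal_tensors P 3" "t - ?D t' \<in> ?V"
      using \<open>t \<in> null_tensors\<close> unfolding null_tensors_def by blast
    then have "fscale a t' \<in> formal_tensors P 3" "fscale a t - ?D (fscale a t') \<in> ?V"
      using module.span_scale[OF module_fscale, of "t - ?D t'"]
        module.subspace_scale[OF module_fscale formal]
      by (auto simp only: D module.scale_right_diff_distrib[OF module_fscale, symmetric])
    then show ?thesis unfolding null_tensors_def by blast
  qed
  ultimately show ?thesis by (simp add: module.subspace_def[OF module_fscale])
qed

lemma relations_null: "tensor_relations s P 3 \<subseteq> null_tensors"
proof
  fix t assume "t \<in> tensor_relations s P 3"
  then have "t - (\<Sum>i<3. tensor_del s i 0) \<in> module.span fscale (tensor_relations s P 3)"
    using span_relations_subset by (auto simp: tensor_del_def)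
  then show "t \<in> null_tensors"
    unfolding null_tensors_def
    using module.subspace_0[OF module_fscale subspace_formal_tensors] by blast
qed

lemma total_del_null:
  assumes "u \<in> P" "v \<in> P" "w \<in> P"
  shows "pure [del s u, v, w] + pure [u, del s v, w] + pure [u, v, del s w] \<in> null_tensors"
proof -
  have "pure [u, v, w] \<in> formal_tensors P 3"
    by (rule pure_in_formal_tensors) (use assms in auto)
  moreover have "(\<Sum>i<3. tensor_del s i (pure [u, v, w])) =
      pure [del s u, v, w] + pure [u, del s v, w] + pure [u, v, del s w]"
    by (simp add: eval_nat_numeral tensor_del_pure)
  ultimately show ?thesis
    unfolding null_tensors_def
    by (auto intro!: bexI[of _ "pure [u, v, w]"] simp: module.span_zero[OF module_fscale])
qed

lemma invariant_trilinear_functional: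
  assumes T: "additive T" "\<And>c t. T (fscale c t) = c * T t" "\<And>t. t \<in> null_tensors \<Longrightarrow> T t = 0"
  shows "invariant_trilinear s P (\<lambda>u v w. T (pure [u, v, w]))"
proof -
  note T_simps = additive.add[OF T(1)] additive.diff[OF T(1)] T(2)
  have add: "T (pure (us @ (x + y) # vs)) = T (pure (us @ x # vs)) + T (pure (us @ y # vs))"
    if "x \<in> P" "y \<in> P" "set us \<subseteq> P" "set vs \<subseteq> P" "length us + 1 + length vs = 3" for us vs x y
  proof -
    have "pure (us @ (x + y) # vs) - pure (us @ x # vs) - pure (us @ y # vs) \<in> tensor_relations s P 3"
      unfolding tensor_relations_def using that by blast
    from T(3)[OF subsetD[OF relations_null this]] show ?thesis by (simp add: T_simps algebra_simps)
  qed
  have scale: "T (pure (us @ kscale s c x # vs)) = c * T (pure (us @ x # vs))"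
    if "x \<in> P" "set us \<subseteq> P" "set vs \<subseteq> P" "length us + 1 + length vs = 3" for us vs x c
  proof -
    have "pure (us @ kscale s c x # vs) - fscale c (pure (us @ x # vs)) \<in> tensor_relations s P 3"
      unfolding tensor_relations_def using that by blast
    from T(3)[OF subsetD[OF relations_null this]] show ?thesis by (simp add: T_simps algebra_simps)
  qed
  show ?thesis
  proof (rule invariant_trilinear.intro)
    show "T (pure [u + u', v, w]) = T (pure [u, v, w]) + T (pure [u', v, w])"
      if "u \<in> P" "u' \<in> P" "v \<in> P" "w \<in> P" for u u' v w
      using add[of u u' "[]" "[v, w]"] that by simp
    show "T (pure [v, u + u', w]) = T (pure [v, u, w]) + T (pure [v, u', w])"
      if "u \<in> P" "u' \<in> P" "v \<in> P" "w \<in> P" for u u' v w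
      using add[of u u' "[v]" "[w]"] that by simp
    show "T (pure [v, w, u + u']) = T (pure [v, w, u]) + T (pure [v, w, u'])"
      if "u \<in> P" "u' \<in> P" "v \<in> P" "w \<in> P" for u u' v w
      using add[of u u' "[v, w]" "[]"] that by simp
    show "T (pure [kscale s c u, v, w]) = c * T (pure [u, v, w])"
      if "u \<in> P" "v \<in> P" "w \<in> P" for c u v w
      using scale[of u "[]" "[v, w]"] that by simp
    show "T (pure [u, kscale s c v, w]) = c * T (pure [u, v, w])"
      if "u \<in> P" "v \<in> P" "w \<in> P" for c u v w
      using scale[of v "[u]" "[w]"] that by simp
    show "T (pure [u, v, kscale s c w]) = c * T (pure [u, v, w])"
      if "u \<in> P" "v \<in> P" "w \<in> P" for c u v w
      using scale[of w "[u, v]" "[]"] that by simp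
    show "T (pure [del s u, v, w]) + T (pure [u, del s v, w]) + T (pure [u, v, del s w]) = 0"
      if "u \<in> P" "v \<in> P" "w \<in> P" for u v w
      using T(3)[OF total_del_null[OF that]] by (simp add: T_simps)
  qed (rule module_s subspace_P)+
qed

text \<open>
If the class of \<open>t\<close> were not in the image of the total derivative, some invariant trilinear
form \<open>T\<close> would not vanish on \<open>t\<close>. Expanding all three factors in the family \<open>e\<close> writes \<open>T(t)\<close> through
linear functionals \<open>\<tau>\<close> of polynomials in two variables, one for each triple of indices. The value of
such a polynomial at \<open>(x,y)\<close> is the evaluation of \<open>t\<close> with \<open>z = -x-y\<close>, so these polynomials vanish.
\<close>

lemma evaluations_separate:
  assumes t: "t \<in> formal_tensors P 3"
    and zero: "\<And>w1 w2 w3 x y z. \<lbrakk>w1 \<in> P; w2 \<in> P; w3 \<in> P; x + y + z = 0\<rbrakk>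
      \<Longrightarrow> linear_extension (eval3 w1 w2 w3 x y z) t = 0"
  shows "tensor_class s P 3 t \<in> total_del_image s P 3"
proof (rule ccontr)
  assume "\<not> ?thesis"
  then have "t \<notin> null_tensors" by (simp add: null_tensors_iff)
  from separating_functional[OF vector_space_fscale subspace_null_tensors this]
  obtain T :: "('p list \<Rightarrow>\<^sub>0 'k) \<Rightarrow> 'k" where T: "additive T" "\<And>c t. T (fscale c t) = c * T t"
    "\<And>t. t \<in> null_tensors \<Longrightarrow> T t = 0" "T t = 1" by blast
  interpret T: invariant_trilinear s P "\<lambda>u v w. T (pure [u, v, w])"
    by (rule invariant_trilinear_functional[OF T(1,2,3)])
  define \<tau> where "\<tau> i j k = T.coefficient_functional (e i) (e j) (e k)" for i j k
  define G where "G i j k xs = tripoly (pr (e' i) (xs ! 0)) (pr (e' j) (xs ! 1)) (pr (e' k) (xs ! 2))"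
    for i j k and xs :: "'p list"
  have T_pure: "T (pure xs) = (\<Sum>i\<in>I. \<Sum>j\<in>I. \<Sum>k\<in>I. \<tau> i j k (G i j k xs))"
    if xs: "length xs = 3" "set xs \<subseteq> P" for xs
  proof -
    obtain u v w where uvw: "xs = [u, v, w]" using xs(1) by (auto simp: eval_nat_numeral length_Suc_conv)
    then have P: "u \<in> P" "v \<in> P" "w \<in> P" using xs(2) by auto
    let ?c = "\<lambda>u i. s (pr (e' i) u) (e i)"
    note closed = scale_in_P e_in_P sum_in_subspace[OF module_s subspace_P]
    note sums = additive_on_sum[OF module_s subspace_P]
    have "T (pure [\<Sum>i\<in>I. ?c u i, \<Sum>j\<in>I. ?c v j, \<Sum>k\<in>I. ?c w k]) =
        (\<Sum>i\<in>I. T (pure [?c u i, \<Sum>j\<in>I. ?c v j, \<Sum>k\<in>I. ?c w k]))"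
      by (rule sums) (auto simp: T.T_add closed)
    also have "\<dots> = (\<Sum>i\<in>I. \<Sum>j\<in>I. T (pure [?c u i, ?c v j, \<Sum>k\<in>I. ?c w k]))"
      by (rule sum.cong[OF refl], rule sums) (auto simp: T.T_add closed)
    also have "\<dots> = (\<Sum>i\<in>I. \<Sum>j\<in>I. \<Sum>k\<in>I. T (pure [?c u i, ?c v j, ?c w k]))"
      by (rule sum.cong[OF refl], rule sum.cong[OF refl], rule sums) (auto simp: T.T_add closed)
    also have "\<dots> = (\<Sum>i\<in>I. \<Sum>j\<in>I. \<Sum>k\<in>I. \<tau> i j k (G i j k xs))"
      by (intro sum.cong refl)
        (simp add: \<tau>_def G_def uvw T.T_eq_coefficient_functional e_in_P eval_nat_numeral)
    finally show ?thesis by (simp add: expand P uvw)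
  qed
  have G_zero: "(\<Sum>xs\<in>Poly_Mapping.keys t. smult [:Poly_Mapping.lookup t xs:] (G i j k xs)) = 0"
    if "i \<in> I" "j \<in> I" "k \<in> I" for i j k
  proof (rule poly_poly_eqI)
    fix y x :: 'k
    have "poly (poly (\<Sum>xs\<in>Poly_Mapping.keys t. smult [:Poly_Mapping.lookup t xs:] (G i j k xs)) [:y:]) x =
        linear_extension (eval3 (e' i) (e' j) (e' k) x y (- x - y)) t"
      using t by (auto simp: poly_sum linear_extension_def G_def poly_poly_tripoly eval3_def formal_tensors_def
          intro!: sum.cong)
    also have "\<dots> = 0" by (rule zero) (simp_all add: e_in_P that)
    finally show "poly (poly (\<Sum>xs\<in>Poly_Mapping.keys t. smult [:Poly_Mapping.lookup t xs:] (G i j k xs)) [:y:]) x =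
      poly (poly 0 [:y:]) x" by simp
  qed
  have "T t = (\<Sum>xs\<in>Poly_Mapping.keys t. Poly_Mapping.lookup t xs * T (pure xs))"
    by (subst functional_eq_lin[OF T(1,2)]) (simp add: linear_extension_def)
  also have "\<dots> = (\<Sum>xs\<in>Poly_Mapping.keys t. \<Sum>i\<in>I. \<Sum>j\<in>I. \<Sum>k\<in>I.
      \<tau> i j k (smult [:Poly_Mapping.lookup t xs:] (G i j k xs)))"
    by (intro sum.cong refl)
      (use t in \<open>auto simp: formal_tensors_def T_pure \<tau>_def T.coefficient_functional_scale e_in_P
        sum_distrib_left intro!: sum.cong\<close>)
  also have "\<dots> = (\<Sum>i\<in>I. \<Sum>j\<in>I. \<Sum>k\<in>I. \<Sum>xs\<in>Poly_Mapping.keys t.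
      \<tau> i j k (smult [:Poly_Mapping.lookup t xs:] (G i j k xs)))"
    by (subst sum.swap, rule sum.cong[OF refl], subst sum.swap, rule sum.cong[OF refl], rule sum.swap)
  also have "\<dots> = (\<Sum>i\<in>I. \<Sum>j\<in>I. \<Sum>k\<in>I. \<tau> i j k
      (\<Sum>xs\<in>Poly_Mapping.keys t. smult [:Poly_Mapping.lookup t xs:] (G i j k xs)))"
    by (intro sum.cong refl)
      (simp add: \<tau>_def additive.sum[OF T.additive_coefficient_functional] e_in_P)
  also have "\<dots> = 0"
    by (intro sum.neutral ballI)
      (simp add: G_zero \<tau>_def additive.zero[OF T.additive_coefficient_functional] e_in_P)
  finally show False using T(4) by simp
qed

lemma fibre_product_left:
  assumes "sesquilinear s P M" "w \<in> P" "u \<in> P"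
  shows "fibre (- l) (\<lambda>v. \<phi> w x (M l v u))"
  unfolding fibre_def using assms by (simp add: sesquilinearD \<phi>_add \<phi>_scale \<phi>_minus)

lemma fibre_product_right:
  assumes "sesquilinear s P M" "w \<in> P" "u \<in> P"
  shows "fibre (l + x) (\<lambda>v. \<phi> w x (M l u v))"
  unfolding fibre_def using assms by (simp add: sesquilinearD \<phi>_add \<phi>_scale algebra_simps)

lemma eval3_psubst:
  assumes D: "\<And>t. linear_extension g (D t) = \<kappa> * linear_extension g t"
    and w: "w \<in> P" and g: "\<And>v. linear_extension g (F v) = \<phi> w x v * C"
  shows "linear_extension g (psubst D F p) = \<phi> w x (ev (kscale s) \<kappa> p) * C"
proof -
  have "linear_extension g (psubst D F p) = psubst ((*) \<kappa>) (\<lambda>v. linear_extension g (F v)) p"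
    by (rule psubst_additive_image[where E = D and E' = "(*) \<kappa>", OF additive_lin D])
  also have "\<dots> = \<phi> w x (ev (kscale s) \<kappa> p) * C"
    unfolding g
    by (rule fibre_ev[OF module_s, symmetric]) (auto simp: additive_def \<phi>_add \<phi>_scale w algebra_simps)
  finally show ?thesis .
qed

lemma psubst_in_formal_tensors:
  assumes "\<And>n. coeff p n \<in> P" "\<And>t. t \<in> formal_tensors P 3 \<Longrightarrow> D t \<in> formal_tensors P 3"
    "\<And>v. v \<in> P \<Longrightarrow> F v \<in> formal_tensors P 3"
  shows "psubst D F p \<in> formal_tensors P 3"
  by (rule psubst_closed)
    (auto simp: assms module.subspace_add[OF module_fscale subspace_formal_tensors]
      module.subspace_0[OF module_fscale subspace_formal_tensors])

text \<open>
Under an evaluation with \<open>x+y+z = 0\<close>, the operators \<open>\<partial>\<^sub>1\<close>, \<open>\<partial>\<^sub>2\<close> and \<open>-\<partial>\<^sub>1-\<partial>\<^sub>2\<close> substituted for \<open>\<mu>\<close>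
become the numbers \<open>x\<close>, \<open>y\<close> and \<open>z\<close>. In each of the four terms the two sums are contractions, which
insert two of the vectors \<open>w\<^sub>1\<close>, \<open>w\<^sub>2\<close>, \<open>w\<^sub>3\<close> into the bracket and leave one number. The hypothesis
\<open>invariance\<close> says that these four numbers cancel.
\<close>

theorem casimir_solves_CLCYBE:
  assumes br: "leibniz_conformal_algebra s P br"
    and invariance: "\<And>w1 w2 w3 x y z. \<lbrakk>w1 \<in> P; w2 \<in> P; w3 \<in> P; x + y + z = 0\<rbrakk> \<Longrightarrow>
      \<phi> w1 x (sprod s br y w2 w3) + \<phi> w3 z (sprod s br y w2 w1) =
      \<phi> w2 y (sprod s br x w1 w3) + \<phi> w2 y (sprod s br z w3 w1)"
  shows "CLCYBE_solution s P br (tensor_class s P 2 casimir)"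
  unfolding CLCYBE_solution_def
proof (intro conjI allI impI)
  show "leibniz_conformal_algebra s P br" by (rule br)
  have "casimir \<in> formal_tensors P 2"
    unfolding casimir_def
    by (rule sum_in_subspace[OF module_fscale subspace_formal_tensors])
      (auto intro!: pure_in_formal_tensors simp: e_in_P)
  then show "tensor_class s P 2 casimir \<in> tensor_power s P 2"
    by (simp add: tensor_power_def)
next
  fix m :: nat and c d :: "nat \<Rightarrow> 'p"
  assume "\<forall>i<m. c i \<in> P \<and> d i \<in> P"
    and pres: "tensor_class s P 2 casimir = tensor_class s P 2 (\<Sum>i<m. pure [c i, d i])"
  then have cd: "\<And>i. i < m \<Longrightarrow> c i \<in> P" "\<And>i. i < m \<Longrightarrow> d i \<in> P" by auto
  have "lambda_product s P br" using br by (simp add: leibniz_conformal_algebra_def)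
  then have coeff_br: "\<And>u v n. u \<in> P \<Longrightarrow> v \<in> P \<Longrightarrow> coeff (br u v) n \<in> P"
    and sesq: "sesquilinear s P (sprod s br)"
    by (simp_all add: lambda_product_iff[OF module_s])
  note contr = contract[OF cd pres]
  show "tensor_class s P 3 (yb_bracket s br m c d) \<in> total_del_image s P 3"
  proof (rule evaluations_separate)
    note sub = subspace_formal_tensors[of P 3]
    note del_formal = tensor_del_in_formal_tensors[OF scale_in_P]
    show "yb_bracket s br m c d \<in> formal_tensors P 3"
      unfolding yb_bracket_def Let_def
      by (intro module.subspace_diff[OF module_fscale sub] module.subspace_add[OF module_fscale sub]
          sum_in_subspace[OF module_fscale sub] psubst_in_formal_tensors coeff_br
          pure_in_formal_tensors module.subspace_neg[OF module_fscale sub] del_formal)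
        (auto simp: cd)
  next
    fix w1 w2 w3 and x y z :: 'k
    assume w: "w1 \<in> P" "w2 \<in> P" "w3 \<in> P" and xyz: "x + y + z = 0"
    let ?g = "eval3 w1 w2 w3 x y z"
    let ?B = "sprod s br"
    note D = eval3_tensor_del[OF w, of x y z]
    have z_eq: "z = - (x + y)" using xyz by (simp add: add_eq_0_iff)
    then have z: "- x - y = z" "- y - x = z" "y + x = - z" "x + y = - z" "y + z = - x" "z + y = - x"
      by (simp_all add: z_eq algebra_simps)
    have D12: "linear_extension ?g (- tensor_del s 0 t - tensor_del s 1 t) = z * linear_extension ?g t" for t
    proof -
      have "linear_extension ?g (- tensor_del s 0 t - tensor_del s 1 t) = - (x * linear_extension ?g t) - y * linear_extension ?g t"
        by (simp only: additive.diff[OF additive_lin] additive.minus[OF additive_lin] D)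
      then show ?thesis by (simp add: z_eq algebra_simps)
    qed
    have t1: "linear_extension ?g (psubst (tensor_del s 1) (\<lambda>v. pure [v, d i, d j]) p) =
        \<phi> w1 x (ev (kscale s) y p) * (\<phi> w2 y (d i) * \<phi> w3 z (d j))" for i j p
      by (rule eval3_psubst[OF D(2) w(1)]) (simp add: lin_pure eval3_def eval_nat_numeral)
    have t2: "linear_extension ?g (psubst (tensor_del s 1) (\<lambda>v. pure [c i, c j, v]) p) =
        \<phi> w3 z (ev (kscale s) y p) * (\<phi> w1 x (c i) * \<phi> w2 y (c j))" for i j p
      by (rule eval3_psubst[OF D(2) w(3)]) (simp add: lin_pure eval3_def eval_nat_numeral)
    have t3: "linear_extension ?g (psubst (tensor_del s 0) (\<lambda>v. pure [c i, v, d j]) p) =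
        \<phi> w2 y (ev (kscale s) x p) * (\<phi> w1 x (c i) * \<phi> w3 z (d j))" for i j p
      by (rule eval3_psubst[OF D(1) w(2)]) (simp add: lin_pure eval3_def eval_nat_numeral)
    have t4: "linear_extension ?g (psubst (\<lambda>t. - tensor_del s 0 t - tensor_del s 1 t) (\<lambda>v. pure [c i, v, d j]) p) =
        \<phi> w2 y (ev (kscale s) z p) * (\<phi> w1 x (c i) * \<phi> w3 z (d j))" for i j p
      by (rule eval3_psubst[OF D12 w(2)]) (simp add: lin_pure eval3_def eval_nat_numeral)
    note fl = fibre_product_left[OF sesq] and fr = fibre_product_right[OF sesq]

    have s1: "(\<Sum>i<m. \<Sum>j<m. \<phi> w1 x (?B y (c i) (c j)) * (\<phi> w2 y (d i) * \<phi> w3 z (d j))) =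
        \<phi> w1 x (?B y w2 w3)"
    proof -
      have inner: "(\<Sum>j<m. \<phi> w1 x (?B y (c i) (c j)) * \<phi> w3 z (d j)) = \<phi> w1 x (?B y (c i) w3)"
        if "i < m" for i
        by (rule contr(2)) (use fr[of w1 "c i" y x] w cd that in \<open>auto simp: z\<close>)
      then have "(\<Sum>i<m. \<Sum>j<m. \<phi> w1 x (?B y (c i) (c j)) * (\<phi> w2 y (d i) * \<phi> w3 z (d j))) =
          (\<Sum>i<m. \<phi> w1 x (?B y (c i) w3) * \<phi> w2 y (d i))"
        by (intro sum.cong refl)
          (simp add: sum_distrib_left sum_distrib_right mult_ac flip: inner)
      also have "\<dots> = \<phi> w1 x (?B y w2 w3)"
        by (rule contr(2)) (use fl w in auto)
      finally show ?thesis .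
    qed
    have s2: "(\<Sum>i<m. \<Sum>j<m. \<phi> w3 z (?B y (d j) (d i)) * (\<phi> w1 x (c i) * \<phi> w2 y (c j))) =
        \<phi> w3 z (?B y w2 w1)"
    proof -
      have inner: "(\<Sum>j<m. \<phi> w2 y (c j) * \<phi> w3 z (?B y (d j) (d i))) = \<phi> w3 z (?B y w2 (d i))"
        if "i < m" for i
        by (rule contr(1)) (use fl w cd that in auto)
      then have "(\<Sum>i<m. \<Sum>j<m. \<phi> w3 z (?B y (d j) (d i)) * (\<phi> w1 x (c i) * \<phi> w2 y (c j))) =
          (\<Sum>i<m. \<phi> w1 x (c i) * \<phi> w3 z (?B y w2 (d i)))"
        by (intro sum.cong refl)
          (simp add: sum_distrib_left sum_distrib_right mult_ac flip: inner)
      also have "\<dots> = \<phi> w3 z (?B y w2 w1)"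
        by (rule contr(1)) (use fr[of w3 w2 y z] w in \<open>auto simp: z\<close>)
      finally show ?thesis .
    qed
    have s3: "(\<Sum>i<m. \<Sum>j<m. \<phi> w2 y (?B x (d i) (c j)) * (\<phi> w1 x (c i) * \<phi> w3 z (d j))) =
        \<phi> w2 y (?B x w1 w3)"
    proof -
      have inner: "(\<Sum>j<m. \<phi> w2 y (?B x (d i) (c j)) * \<phi> w3 z (d j)) = \<phi> w2 y (?B x (d i) w3)"
        if "i < m" for i
        by (rule contr(2)) (use fr[of w2 "d i" x y] w cd that in \<open>auto simp: z\<close>)
      then have "(\<Sum>i<m. \<Sum>j<m. \<phi> w2 y (?B x (d i) (c j)) * (\<phi> w1 x (c i) * \<phi> w3 z (d j))) =
          (\<Sum>i<m. \<phi> w1 x (c i) * \<phi> w2 y (?B x (d i) w3))"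
        by (intro sum.cong refl)
          (simp add: sum_distrib_left sum_distrib_right mult_ac flip: inner)
      also have "\<dots> = \<phi> w2 y (?B x w1 w3)"
        by (rule contr(1)) (use fl w in auto)
      finally show ?thesis .
    qed
    have s4: "(\<Sum>i<m. \<Sum>j<m. \<phi> w2 y (?B z (c j) (d i)) * (\<phi> w1 x (c i) * \<phi> w3 z (d j))) =
        \<phi> w2 y (?B z w3 w1)"
    proof -
      have inner: "(\<Sum>j<m. \<phi> w2 y (?B z (c j) (d i)) * \<phi> w3 z (d j)) = \<phi> w2 y (?B z w3 (d i))"
        if "i < m" for i
        by (rule contr(2)) (use fl w cd that in auto)
      then have "(\<Sum>i<m. \<Sum>j<m. \<phi> w2 y (?B z (c j) (d i)) * (\<phi> w1 x (c i) * \<phi> w3 z (d j))) =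
          (\<Sum>i<m. \<phi> w1 x (c i) * \<phi> w2 y (?B z w3 (d i)))"
        by (intro sum.cong refl)
          (simp add: sum_distrib_left sum_distrib_right mult_ac flip: inner)
      also have "\<dots> = \<phi> w2 y (?B z w3 w1)"
        by (rule contr(1)) (use fr[of w2 w3 z y] w in \<open>auto simp: z\<close>)
      finally show ?thesis .
    qed
    have "linear_extension ?g (yb_bracket s br m c d) = \<phi> w1 x (?B y w2 w3) + \<phi> w3 z (?B y w2 w1)
        - \<phi> w2 y (?B x w1 w3) - \<phi> w2 y (?B z w3 w1)"
      unfolding yb_bracket_def Let_def
      by (simp only: additive.diff[OF additive_lin] additive.add[OF additive_lin]
          additive.sum[OF additive_lin] t1 t2 t3 t4 s1 s2 s3 s4)
    then show "linear_extension ?g (yb_bracket s br m c d) = 0"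
      using invariance[OF w xyz] by (simp add: algebra_simps)
  qed
qed

end


section \<open>The pairing between an algebra and its conformal dual\<close>

lemma pcompose_uminus_involution: "pcompose (pcompose p [:0, -1:]) [:0, -1:] = p"
  for p :: "'k::field poly"
proof -
  have "pcompose [:0, -1:] [:0, -1:] = [:0, 1 :: 'k:]" by (simp add: pcompose_pCons)
  then show ?thesis by (simp add: pcompose_assoc[symmetric] pcompose_idR)
qed

context finite_leibniz_dendriform
begin

definition pairing :: "'q \<times> ('q \<Rightarrow> 'k poly) \<Rightarrow> 'q \<times> ('q \<Rightarrow> 'k poly) \<Rightarrow> 'k poly" where
  "pairing u v = snd u (fst v) + pcompose (snd v (fst u)) [:0, -1:]"

lemma poly_pairing: "poly (pairing u v) x = poly (snd u (fst v)) x + poly (snd v (fst u)) (- x)"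
  by (simp add: pairing_def poly_pcompose)

lemma pairing_sym: "pairing v u = pcompose (pairing u v) [:0, -1:]"
  by (simp add: pairing_def pcompose_add pcompose_uminus_involution)

lemma pairing_linear:
  assumes "w \<in> double"
  shows "pairing w (u + v) = pairing w u + pairing w v"
    and "pairing w (double_scale p u) = p * pairing w u"
proof -
  have "snd w \<in> conf_dual scale" using assms by (auto simp: double_def)
  then show "pairing w (u + v) = pairing w u + pairing w v"
    and "pairing w (double_scale p u) = p * pairing w u"
    by (simp_all add: pairing_def conf_dual_iff[OF module_scale] double_scale_def sum_scale_def
        dual_scale_def pcompose_add pcompose_mult pcompose_uminus_involution algebra_simps)
qed

text \<open>
Written out with the formula for the bracket, both sides are equal to
\<open>f\<^sub>1(b\<^sub>2 \<triangleright>\<^sub>y b\<^sub>3)\<^sub>x + f\<^sub>3(b\<^sub>2 \<triangleright>\<^sub>y b\<^sub>1)\<^sub>z + f\<^sub>2([b\<^sub>3 \<^sub>z b\<^sub>1] + [b\<^sub>1 \<^sub>x b\<^sub>3])\<^sub>y\<close> for \<open>w\<^sub>i = b\<^sub>i + f\<^sub>i\<close>: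
the products \<open>\<triangleleft>\<close> coming from \<open>[b\<^sub>2 b\<^sub>3]\<close> and \<open>[b\<^sub>2 b\<^sub>1]\<close> cancel against the dual left action.
\<close>

lemma pairing_invariant:
  assumes w: "w1 \<in> double" "w2 \<in> double" "w3 \<in> double" and "x + y + z = 0"
  shows "poly (pairing w1 (DB y w2 w3)) x + poly (pairing w3 (DB y w2 w1)) z =
    poly (pairing w2 (DB x w1 w3)) y + poly (pairing w2 (DB z w3 w1)) y"
proof -
  have z_eq: "z = - (x + y)" using assms(4) by (simp add: add_eq_0_iff)
  have z: "- x - y = z" "- y - x = z" "- z - y = x" "- y - z = x" "- x - z = y" "- z - x = y"
    by (simp_all add: z_eq algebra_simps)
  show ?thesis
    by (simp add: poly_pairing fst_DB snd_DB w double_fibre z)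
qed

end

theorem theorem4p16:
  fixes scale :: "'k::field_char_0 poly \<Rightarrow> 'q::ab_group_add \<Rightarrow> 'q"
    and lt rt :: "'q \<Rightarrow> 'q \<Rightarrow> 'q poly"
    and n :: nat
    and a :: "nat \<Rightarrow> 'q"
    and \<alpha> :: "nat \<Rightarrow> 'q \<Rightarrow> 'k poly"
  assumes "leibniz_dendriform_conformal_algebra scale lt rt"
    and basis: "inj_on a {1..n}" "\<not> module.dependent scale (a ` {1..n})"
      "module.span scale (a ` {1..n}) = UNIV"
    and dual_basis: "\<And>i. i \<in> {1..n} \<Longrightarrow> \<alpha> i \<in> conf_dual scale"
      "\<And>i j. i \<in> {1..n} \<Longrightarrow> j \<in> {1..n} \<Longrightarrow> \<alpha> i (a j) = (if i = j then 1 else 0)"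
  defines "Ls \<equiv> dual_action (left_mult lt)"
    and "Rs \<equiv> dual_action (right_mult scale rt)"
  defines "P \<equiv> UNIV \<times> conf_dual scale"
    and "sP \<equiv> sum_scale scale dual_scale"
    and "br \<equiv> semidirect_bracket dual_scale (sum_product rt lt) Ls (\<lambda>b f. - Ls b f - Rs b f)"
  shows "CLCYBE_solution sP P br
    (tensor_class sP P 2 (\<Sum>i=1..n. pure [(0, \<alpha> i), (a i, 0)] + pure [(a i, 0), (0, \<alpha> i)]))"
proof -
  note One_nat_def [simp del]
  interpret Q: leibniz_dendriform_conformal_algebra scale lt rt by fact
  interpret Q: finite_leibniz_dendriform scale lt rt "a ` {1..n}"
    by unfold_locales (rule finite_imageI finite_atLeastAtMost basis)+
  have defs: "P = Q.double" "sP = Q.double_scale" "br = Q.double_bracket"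
    by (simp_all add: P_def sP_def br_def Ls_def Rs_def Q.double_def Q.double_scale_def Q.double_bracket_def
        Q.Ls_def Q.Rs_def)

  have vec: "(\<Sum>i=1..n. scale (\<alpha> i v) (a i)) = v" for v
  proof -
    let ?V = "{v. (\<Sum>i=1..n. scale (\<alpha> i v) (a i)) = v}"
    note dual = dual_basis(1)[unfolded conf_dual_iff[OF Q.module_scale]]
    have "Q.subspace ?V"
    proof (rule Q.subspaceI)
      show "0 \<in> ?V"
        by (simp add: additive.zero[of "\<alpha> _", OF additive.intro] dual)
      show "u + v \<in> ?V" if "u \<in> ?V" "v \<in> ?V" for u v
        using that by (simp add: dual Q.scale_left_distrib sum.distrib)
      show "scale p v \<in> ?V" if "v \<in> ?V" for p v
        using that by (simp add: dual Q.scale_scale[symmetric] Q.scale_sum_right[symmetric]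
            del: Q.scale_scale)
    qed
    moreover have "a ` {1..n} \<subseteq> ?V"
      by (auto simp: dual_basis(2) if_distrib[of "\<lambda>p. scale p _"] cong: if_cong)
    ultimately show ?thesis using Q.span_minimal basis(3) by blast
  qed
  have covec: "(\<Sum>i=1..n. g (a i) * \<alpha> i v) = g v" if "g \<in> conf_dual scale" for g v
  proof -
    note g = that[unfolded conf_dual_iff[OF Q.module_scale]]
    have "g (\<Sum>i=1..n. scale (\<alpha> i v) (a i)) = (\<Sum>i=1..n. g (scale (\<alpha> i v) (a i)))"
      by (rule additive.sum) (simp add: additive_def g)
    then show ?thesis by (simp add: vec g mult.commute)
  qed

  \<comment> \<open>the dual families: each pair \<open>(a\<^sub>i, \<alpha>\<^sub>i)\<close> occurs in both orders\<close>
  define I where "I = {1..n} \<times> (UNIV :: bool set)"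
  define e where "e = (\<lambda>(i, b). if b then (0, \<alpha> i) else (a i, 0))"
  define e' where "e' = (\<lambda>(i, b). if b then (a i, 0) else (0, \<alpha> i))"
  have sum_I: "(\<Sum>k\<in>I. f k) = (\<Sum>i=1..n. f (i, True) + f (i, False))"
    for f :: "nat \<times> bool \<Rightarrow> 'x::comm_monoid_add"
    by (simp add: I_def sum.cartesian_product[symmetric, of "\<lambda>i b. f (i, b)", simplified] UNIV_bool add.commute)
  have expand: "(\<Sum>i=1..n. sP (Q.pairing (a i, 0) u) (0, \<alpha> i) + sP (Q.pairing (0, \<alpha> i) u) (a i, 0)) = u"
    if "u \<in> P" for u
  proof -
    have u: "snd u \<in> conf_dual scale" using that by (auto simp: P_def)
    then have 0: "snd u 0 = 0"
      by (intro additive.zero additive.intro) (simp add: conf_dual_iff[OF Q.module_scale])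
    from u have "(\<Sum>i=1..n. dual_scale (pcompose (snd u (a i)) [:0, -1:]) (\<alpha> i)) = snd u"
      by (simp add: fun_eq_iff dual_scale_def pcompose_uminus_involution covec
          additive.sum[OF additive.intro, of "\<lambda>g. g _"])
    then show ?thesis
      by (simp add: prod_eq_iff fst_sum snd_sum sP_def sum_scale_def Q.pairing_def vec 0
          module.scale_zero_right[OF module_dual_scale])
  qed

  interpret perfect_pairing Q.double_scale Q.double Q.pairing I e e'
  proof (rule perfect_pairing.intro)
    have 0: "0 \<in> conf_dual scale" by (simp add: conf_dual_iff[OF Q.module_scale])
    show "e i \<in> Q.double" "e' i \<in> Q.double" if "i \<in> I" for i
      using that dual_basis(1) 0
      by (auto simp: I_def e_def e'_def Q.double_def split: if_splits)
    show "(\<Sum>i\<in>I. Q.double_scale (Q.pairing (e' i) u) (e i)) = u"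
      "(\<Sum>i\<in>I. Q.double_scale (Q.pairing (e i) u) (e' i)) = u" if "u \<in> Q.double" for u
      using expand[of u] that by (simp_all add: sum_I e_def e'_def defs add.commute)
  qed (auto simp: Q.module_double_scale Q.subspace_double I_def Q.pairing_linear intro: Q.pairing_sym)
  have casimir: "casimir = (\<Sum>i=1..n. pure [(0, \<alpha> i), (a i, 0)] + pure [(a i, 0), (0, \<alpha> i)])"
    unfolding casimir_def sum_I by (simp add: e_def e'_def)
  have "CLCYBE_solution Q.double_scale Q.double Q.double_bracket
      (tensor_class Q.double_scale Q.double 2 casimir)"
    by (rule casimir_solves_CLCYBE) (rule Q.leibniz_double, rule Q.pairing_invariant)
  then show ?thesis by (simp only: defs casimir)
qed

end
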